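(* Let $\mathcal{H}\subset TX_1$ be an integrable connection on a Lie groupoid $\mathbb{X}=[X_1\rightrightarrows X_0]$. Let $\varphi:X_0\to\bigwedge^kT^*X_0$ be a differential $k$-form on $\mathbb{X}$ (with respect to $\mathcal{H}$). Then $d\varphi:X_0\to\bigwedge^{k+1}T^*X_0$ is a differential $(k+1)$-form on $\mathbb{X}$ (with respect to $\mathcal{H}$).
   Context: Manifolds are $C^\infty$ and second countable, not necessarily Hausdorff. A Lie groupoid $\mathbb{X}=[X_1\rightrightarrows X_0]$ has smooth structure maps $s,t,m,e,i$ (source, target, multiplication, identity section, inversion), with $s$ (hence $t$) a submersion; $\gamma\circ\gamma'$ is defined when $s(\gamma)=t(\gamma')$. A connection on $\mathbb{X}$ is a smooth distribution $\mathcal{H}\subset TX_1$ such that (1) $T_\gamma X_1=\mathcal{H}_\gamma\oplus\ker(ds)_\gamma$ for all $\gamma\in X_1$; (2) $(de)_x(T_xX_0)=\mathcal{H}_{e(x)}$ for all $x\in X_0$; (3) $\theta_\gamma\circ\theta_{\gamma'}=\theta_{\gamma\circ\gamma'}$ for all composable $\gamma,\gamma'$, where $\theta_\gamma:T_{s(\gamma)}X_0\to T_{t(\gamma)}X_0$ is $(dt)_\gamma\circ((ds)_\gamma|_{\mathcal{H}_\gamma})^{-1}$. It is integrable if the distribution $\mathcal{H}$ is integrable. Let $P_{\mathcal{H}_\gamma}:T_\gamma X_1\to\mathcal{H}_\gamma$ be the projection along $\ker(ds)_\gamma$. For a $k$-form $\varphi$ on $X_1$ put $\widehat{\mathcal{H}}(\varphi)(\gamma)(v_1,\dots,v_k)=\varphi(\gamma)(P_{\mathcal{H}_\gamma}v_1,\dots,P_{\mathcal{H}_\gamma}v_k)$.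 A differential $k$-form $\varphi$ on $X_0$ is a differential $k$-form on $\mathbb{X}$ (with respect to $\mathcal{H}$) if $\widehat{\mathcal{H}}(s^*\varphi)=\widehat{\mathcal{H}}(t^*\varphi)$. *)

theory Defs
  imports "HOL-Analysis.Analysis"
begin

section \<open>Smooth maps between normed spaces\<close>

text \<open>Used for open \<open>S\<close> in finite-dimensional spaces only, where this is the usual notion of
  class \<open>C\<^sup>k\<close>: all iterated directional derivatives of order at most \<open>k\<close> exist and are continuous.\<close>

fun Ck_on :: "nat \<Rightarrow> 'a::real_normed_vector set \<Rightarrow> ('a \<Rightarrow> 'b::real_normed_vector) \<Rightarrow> bool" where
  "Ck_on 0 S f \<longleftrightarrow> continuous_on S f"
| "Ck_on (Suc k) S f \<longleftrightarrow> (\<forall>x\<in>S. f differentiable (at x)) \<and>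
     (\<forall>v. Ck_on k S (\<lambda>x. frechet_derivative f (at x) v))"

definition smooth_on :: "'a::real_normed_vector set \<Rightarrow> ('a \<Rightarrow> 'b::real_normed_vector) \<Rightarrow> bool" where
  "smooth_on S f \<longleftrightarrow> (\<forall>k. Ck_on k S f)"


section \<open>Smooth manifolds\<close>

text \<open>A chart is a domain together with a coordinate map into the model space. The model space is a
  finite-dimensional real normed space; it is not taken from the class \<^class>\<open>euclidean_space\<close>, since
  that class excludes dimension 0 and thus, for instance, a groupoid with a single object.\<close>

type_synonym ('p, 'e) chart = "'p set \<times> ('p \<Rightarrow> 'e)"

abbreviation cdom :: "('p, 'e) chart \<Rightarrow> 'p set" where "cdom \<equiv> fst"
abbreviation cmap :: "('p, 'e) chart \<Rightarrow> 'p \<Rightarrow> 'e" where "cmap \<equiv> snd"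

definition cinv :: "('p, 'e) chart \<Rightarrow> 'e \<Rightarrow> 'p" where
  "cinv c = inv_into (cdom c) (cmap c)"

record ('p, 'e) manifold =
  top_of :: "'p topology"
  atlas :: "('p, 'e) chart set"

abbreviation points :: "('p, 'e, 'z) manifold_scheme \<Rightarrow> 'p set" where
  "points M \<equiv> topspace (top_of M)"

text \<open>The atlas need not be maximal, and the topology need not be Hausdorff.\<close>

definition smooth_manifold :: "('p, 'e::real_normed_vector) manifold \<Rightarrow> bool" where
  "smooth_manifold M \<longleftrightarrow>
     (\<exists>B :: 'e set. finite B \<and> span B = UNIV) \<and>
     second_countable (top_of M) \<and>
     (\<Union>c\<in>atlas M. cdom c) = points M \<and>
     (\<forall>c\<in>atlas M. openin (top_of M) (cdom c) \<and> open (cmap c ` cdom c) \<and>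
        homeomorphic_map (subtopology (top_of M) (cdom c))
          (top_of_set (cmap c ` cdom c)) (cmap c)) \<and>
     (\<forall>c\<in>atlas M. \<forall>d\<in>atlas M. smooth_on (cmap c ` (cdom c \<inter> cdom d)) (cmap d \<circ> cinv c))"

definition smooth_map ::
  "('p, 'e::real_normed_vector) manifold \<Rightarrow> ('q, 'f::real_normed_vector) manifold \<Rightarrow> ('p \<Rightarrow> 'q) \<Rightarrow> bool" where
  "smooth_map M N f \<longleftrightarrow> continuous_map (top_of M) (top_of N) f \<and>
     (\<forall>c\<in>atlas M. \<forall>d\<in>atlas N.
        smooth_on (cmap c ` {p \<in> cdom c. f p \<in> cdom d}) (cmap d \<circ> f \<circ> cinv c))"

definition open_submanifold :: "('p, 'e) manifold \<Rightarrow> 'p set \<Rightarrow> ('p, 'e) manifold" where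
  "open_submanifold M W =
     \<lparr>top_of = subtopology (top_of M) W, atlas = (\<lambda>c. (cdom c \<inter> W, cmap c)) ` atlas M\<rparr>"

definition product_manifold :: "('p, 'e) manifold \<Rightarrow> ('q, 'f) manifold \<Rightarrow> ('p \<times> 'q, 'e \<times> 'f) manifold" where
  "product_manifold M N =
     \<lparr>top_of = prod_topology (top_of M) (top_of N),
      atlas = {(cdom c \<times> cdom d, map_prod (cmap c) (cmap d)) |c d. c \<in> atlas M \<and> d \<in> atlas N}\<rparr>"

text \<open>Smoothness of a map defined on a subset \<open>S\<close> of a manifold: local extendability to smooth maps
  on open sets. If \<open>S\<close> is an embedded submanifold, this is smoothness on that submanifold.\<close>

definition smooth_map_on_subset ::
  "('p, 'e::real_normed_vector) manifold \<Rightarrow> ('q, 'f::real_normed_vector) manifold \<Rightarrow>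
   'p set \<Rightarrow> ('p \<Rightarrow> 'q) \<Rightarrow> bool" where
  "smooth_map_on_subset M N S f \<longleftrightarrow>
     (\<forall>p\<in>S. \<exists>W F. openin (top_of M) W \<and> p \<in> W \<and>
        smooth_map (open_submanifold M W) N F \<and> (\<forall>q\<in>W \<inter> S. F q = f q))"


section \<open>Tangent vectors\<close>

text \<open>Every point \<open>p\<close> has a preferred chart \<open>chart_at M p\<close>, and \<open>T\<^sub>pM\<close> is identified with the model
  space by means of it: a tangent vector at \<open>p\<close> is represented by its components in the preferred
  chart at \<open>p\<close>. So a term of the model type is a tangent vector only relative to a base point, and
  the components in another chart are obtained by \<open>to_chart\<close>.\<close>

definition chart_at :: "('p, 'e) manifold \<Rightarrow> 'p \<Rightarrow> ('p, 'e) chart" where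
  "chart_at M p = (SOME c. c \<in> atlas M \<and> p \<in> cdom c)"

definition to_chart ::
  "('p, 'e::real_normed_vector) manifold \<Rightarrow> ('p, 'e) chart \<Rightarrow> 'p \<Rightarrow> 'e \<Rightarrow> 'e" where
  "to_chart M c p =
     frechet_derivative (cmap c \<circ> cinv (chart_at M p)) (at (cmap (chart_at M p) p))"

definition from_chart ::
  "('p, 'e::real_normed_vector) manifold \<Rightarrow> ('p, 'e) chart \<Rightarrow> 'p \<Rightarrow> 'e \<Rightarrow> 'e" where
  "from_chart M c p = frechet_derivative (cmap (chart_at M p) \<circ> cinv c) (at (cmap c p))"

text \<open>\<open>tangent_map M N f p\<close> is the differential \<open>(df)\<^sub>p\<close> from \<open>T\<^sub>pM\<close> to the tangent space of \<open>N\<close> at \<open>f p\<close>.\<close>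

definition tangent_map ::
  "('p, 'e::real_normed_vector) manifold \<Rightarrow> ('q, 'f::real_normed_vector) manifold \<Rightarrow>
   ('p \<Rightarrow> 'q) \<Rightarrow> 'p \<Rightarrow> 'e \<Rightarrow> 'f" where
  "tangent_map M N f p =
     frechet_derivative (cmap (chart_at N (f p)) \<circ> f \<circ> cinv (chart_at M p))
       (at (cmap (chart_at M p) p))"

definition submersion ::
  "('p, 'e::real_normed_vector) manifold \<Rightarrow> ('q, 'f::real_normed_vector) manifold \<Rightarrow> ('p \<Rightarrow> 'q) \<Rightarrow> bool" where
  "submersion M N f \<longleftrightarrow> smooth_map M N f \<and> (\<forall>p\<in>points M. surj (tangent_map M N f p))"

definition immersion ::
  "('p, 'e::real_normed_vector) manifold \<Rightarrow> ('q, 'f::real_normed_vector) manifold \<Rightarrow> ('p \<Rightarrow> 'q) \<Rightarrow> bool" where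
  "immersion M N f \<longleftrightarrow> smooth_map M N f \<and> (\<forall>p\<in>points M. inj (tangent_map M N f p))"

definition smooth_vector_field_on ::
  "('p, 'e::real_normed_vector) manifold \<Rightarrow> 'p set \<Rightarrow> ('p \<Rightarrow> 'e) \<Rightarrow> bool" where
  "smooth_vector_field_on M W Y \<longleftrightarrow>
     (\<forall>c\<in>atlas M. smooth_on (cmap c ` (cdom c \<inter> W))
        (\<lambda>x. to_chart M c (cinv c x) (Y (cinv c x))))"


section \<open>Distributions\<close>

definition smooth_distribution ::
  "('p, 'e::real_normed_vector) manifold \<Rightarrow> ('p \<Rightarrow> 'e set) \<Rightarrow> bool" where
  "smooth_distribution M D \<longleftrightarrow>
     (\<exists>r. (\<forall>p\<in>points M. subspace (D p) \<and> dim (D p) = r) \<and>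
       (\<forall>p\<in>points M. \<exists>W Y. openin (top_of M) W \<and> p \<in> W \<and>
          (\<forall>i<r. smooth_vector_field_on M W (Y i)) \<and>
          (\<forall>q\<in>W. D q = span ((\<lambda>i::nat. Y i q) ` {..<r}))))"

text \<open>An integral manifold is an immersed submanifold \<open>N\<close> (with its own topology, in general finer
  than the subspace topology) with \<open>T\<^sub>qN = D\<^sub>q\<close> for all \<open>q \<in> N\<close>.\<close>

definition integral_manifold ::
  "('p, 'e::real_normed_vector) manifold \<Rightarrow> ('p \<Rightarrow> 'e set) \<Rightarrow> ('p, 'n::real_normed_vector) manifold \<Rightarrow> bool" where
  "integral_manifold M D N \<longleftrightarrow> smooth_manifold N \<and> immersion N M (\<lambda>q. q) \<and>
     (\<forall>q\<in>points N. range (tangent_map N M (\<lambda>q. q) q) = D q)"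

text \<open>The type argument is the model space of the integral manifolds; its dimension has to be the
  rank of the distribution.\<close>

definition integrable_distribution ::
  "'n::real_normed_vector itself \<Rightarrow> ('p, 'e::real_normed_vector) manifold \<Rightarrow> ('p \<Rightarrow> 'e set) \<Rightarrow> bool" where
  "integrable_distribution T M D \<longleftrightarrow>
     (\<forall>p\<in>points M. \<exists>N :: ('p, 'n) manifold. integral_manifold M D N \<and> p \<in> points N)"


section \<open>Differential forms\<close>

text \<open>A \<open>k\<close>-linear alternating form is a function of sequences of vectors that depends on the entries
  with index below \<open>k\<close> only.\<close>

definition alternating_form :: "nat \<Rightarrow> ((nat \<Rightarrow> 'e::real_vector) \<Rightarrow> real) \<Rightarrow> bool" where
  "alternating_form k \<omega> \<longleftrightarrow>
     (\<forall>v w. (\<forall>i<k. v i = w i) \<longrightarrow> \<omega> v = \<omega> w) \<and>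
     (\<forall>v. \<forall>i<k. linear (\<lambda>x. \<omega> (v(i := x)))) \<and>
     (\<forall>v. \<forall>i<k. \<forall>j<k. i \<noteq> j \<and> v i = v j \<longrightarrow> \<omega> v = 0)"

type_synonym ('p, 'e) form = "'p \<Rightarrow> (nat \<Rightarrow> 'e) \<Rightarrow> real"

definition form_in_chart ::
  "('p, 'e::real_normed_vector) manifold \<Rightarrow> ('p, 'e) chart \<Rightarrow> ('p, 'e) form \<Rightarrow> ('e, 'e) form" where
  "form_in_chart M c \<phi> x v = \<phi> (cinv c x) (\<lambda>i. from_chart M c (cinv c x) (v i))"

definition differential_form ::
  "('p, 'e::real_normed_vector) manifold \<Rightarrow> nat \<Rightarrow> ('p, 'e) form \<Rightarrow> bool" where
  "differential_form M k \<phi> \<longleftrightarrow>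
     (\<forall>p\<in>points M. alternating_form k (\<phi> p)) \<and>
     (\<forall>c\<in>atlas M. \<forall>v. smooth_on (cmap c ` cdom c) (\<lambda>x. form_in_chart M c \<phi> x v))"

definition pullback ::
  "('p, 'e::real_normed_vector) manifold \<Rightarrow> ('q, 'f::real_normed_vector) manifold \<Rightarrow>
   ('p \<Rightarrow> 'q) \<Rightarrow> ('q, 'f) form \<Rightarrow> ('p, 'e) form" where
  "pullback M N f \<phi> p v = \<phi> (f p) (\<lambda>i. tangent_map M N f p (v i))"

text \<open>Exterior derivative of a \<open>k\<close>-form on an open subset of the model space:
  \<open>d\<omega>\<^sub>x(v\<^sub>0,\<dots>,v\<^sub>k) = \<Sum>\<^sub>i (-1)\<^sup>i D(y \<mapsto> \<omega>\<^sub>y(v\<^sub>0,\<dots>,v\<^sub>k without v\<^sub>i))(x)(v\<^sub>i)\<close>.\<close>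

definition local_ext_deriv :: "nat \<Rightarrow> ('e::real_normed_vector, 'e) form \<Rightarrow> ('e, 'e) form" where
  "local_ext_deriv k \<omega> x v =
     (\<Sum>i\<le>k. (-1) ^ i *
        frechet_derivative (\<lambda>y. \<omega> y (\<lambda>j. if j < i then v j else v (Suc j))) (at x) (v i))"

text \<open>On a manifold the value at \<open>p\<close> is computed in the preferred chart at \<open>p\<close>, in which the vectors of
  \<open>T\<^sub>pM\<close> already are given by their components.\<close>

definition ext_deriv ::
  "('p, 'e::real_normed_vector) manifold \<Rightarrow> nat \<Rightarrow> ('p, 'e) form \<Rightarrow> ('p, 'e) form" where
  "ext_deriv M k \<phi> p =
     local_ext_deriv k (form_in_chart M (chart_at M p) \<phi>) (cmap (chart_at M p) p)"


section \<open>Lie groupoids and connections\<close>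

record ('a, 'e, 'b, 'f) groupoid =
  Obj :: "('a, 'e) manifold"
  Arr :: "('b, 'f) manifold"
  src :: "'b \<Rightarrow> 'a"
  tgt :: "'b \<Rightarrow> 'a"
  mult :: "'b \<Rightarrow> 'b \<Rightarrow> 'b"
  ident :: "'a \<Rightarrow> 'b"
  invs :: "'b \<Rightarrow> 'b"

definition composable :: "('a, 'e, 'b, 'f) groupoid \<Rightarrow> ('b \<times> 'b) set" where
  "composable X = {(g, h). g \<in> points (Arr X) \<and> h \<in> points (Arr X) \<and> src X g = tgt X h}"

definition groupoid_laws :: "('a, 'e, 'b, 'f) groupoid \<Rightarrow> bool" where
  "groupoid_laws X \<longleftrightarrow>
     (\<forall>g\<in>points (Arr X). src X g \<in> points (Obj X) \<and> tgt X g \<in> points (Obj X)) \<and>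
     (\<forall>(g, h)\<in>composable X. mult X g h \<in> points (Arr X) \<and>
        src X (mult X g h) = src X h \<and> tgt X (mult X g h) = tgt X g) \<and>
     (\<forall>g h k. (g, h) \<in> composable X \<and> (h, k) \<in> composable X \<longrightarrow>
        mult X (mult X g h) k = mult X g (mult X h k)) \<and>
     (\<forall>x\<in>points (Obj X). ident X x \<in> points (Arr X) \<and>
        src X (ident X x) = x \<and> tgt X (ident X x) = x) \<and>
     (\<forall>g\<in>points (Arr X). mult X g (ident X (src X g)) = g \<and> mult X (ident X (tgt X g)) g = g) \<and>
     (\<forall>g\<in>points (Arr X). invs X g \<in> points (Arr X) \<and>
        src X (invs X g) = tgt X g \<and> tgt X (invs X g) = src X g \<and>
        mult X g (invs X g) = ident X (tgt X g) \<and> mult X (invs X g) g = ident X (src X g))"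

definition lie_groupoid ::
  "('a, 'e::real_normed_vector, 'b, 'f::real_normed_vector) groupoid \<Rightarrow> bool" where
  "lie_groupoid X \<longleftrightarrow>
     smooth_manifold (Obj X) \<and> smooth_manifold (Arr X) \<and> groupoid_laws X \<and>
     submersion (Arr X) (Obj X) (src X) \<and>
     smooth_map (Arr X) (Obj X) (tgt X) \<and>
     smooth_map (Obj X) (Arr X) (ident X) \<and>
     smooth_map (Arr X) (Arr X) (invs X) \<and>
     smooth_map_on_subset (product_manifold (Arr X) (Arr X)) (Arr X) (composable X)
       (\<lambda>(g, h). mult X g h)"

abbreviation dsrc ::
  "('a, 'e::real_normed_vector, 'b, 'f::real_normed_vector) groupoid \<Rightarrow> 'b \<Rightarrow> 'f \<Rightarrow> 'e" where
  "dsrc X \<equiv> tangent_map (Arr X) (Obj X) (src X)"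

abbreviation dtgt ::
  "('a, 'e::real_normed_vector, 'b, 'f::real_normed_vector) groupoid \<Rightarrow> 'b \<Rightarrow> 'f \<Rightarrow> 'e" where
  "dtgt X \<equiv> tangent_map (Arr X) (Obj X) (tgt X)"

definition ker_dsrc ::
  "('a, 'e::real_normed_vector, 'b, 'f::real_normed_vector) groupoid \<Rightarrow> 'b \<Rightarrow> 'f set" where
  "ker_dsrc X g = {v. dsrc X g v = 0}"

definition transport ::
  "('a, 'e::real_normed_vector, 'b, 'f::real_normed_vector) groupoid \<Rightarrow>
   ('b \<Rightarrow> 'f set) \<Rightarrow> 'b \<Rightarrow> 'e \<Rightarrow> 'e" where
  "transport X H g = dtgt X g \<circ> inv_into (H g) (dsrc X g)"

definition connection ::
  "('a, 'e::real_normed_vector, 'b, 'f::real_normed_vector) groupoid \<Rightarrow> ('b \<Rightarrow> 'f set) \<Rightarrow> bool" where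
  "connection X H \<longleftrightarrow>
     smooth_distribution (Arr X) H \<and>
     (\<forall>g\<in>points (Arr X). H g \<inter> ker_dsrc X g = {0} \<and>
        (\<forall>v. \<exists>h\<in>H g. \<exists>w\<in>ker_dsrc X g. v = h + w)) \<and>
     (\<forall>x\<in>points (Obj X). range (tangent_map (Obj X) (Arr X) (ident X) x) = H (ident X x)) \<and>
     (\<forall>(g, h)\<in>composable X. transport X H g \<circ> transport X H h = transport X H (mult X g h))"

text \<open>Since \<open>(ds)\<^sub>\<gamma>\<close> maps \<open>\<H>\<^sub>\<gamma>\<close> isomorphically onto the tangent space of \<open>X\<^sub>0\<close> at \<open>s(\<gamma>)\<close>, the rank of \<open>\<H>\<close>
  is the dimension of \<open>X\<^sub>0\<close>, so the integral manifolds have the same model space as \<open>X\<^sub>0\<close>.\<close>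

definition integrable_connection ::
  "('a, 'e::real_normed_vector, 'b, 'f::real_normed_vector) groupoid \<Rightarrow> ('b \<Rightarrow> 'f set) \<Rightarrow> bool" where
  "integrable_connection X H \<longleftrightarrow>
     connection X H \<and> integrable_distribution TYPE('e) (Arr X) H"

definition horizontal_proj ::
  "('a, 'e::real_normed_vector, 'b, 'f::real_normed_vector) groupoid \<Rightarrow>
   ('b \<Rightarrow> 'f set) \<Rightarrow> 'b \<Rightarrow> 'f \<Rightarrow> 'f" where
  "horizontal_proj X H g v = (THE h. h \<in> H g \<and> v - h \<in> ker_dsrc X g)"

definition horizontal_part ::
  "('a, 'e::real_normed_vector, 'b, 'f::real_normed_vector) groupoid \<Rightarrow>
   ('b \<Rightarrow> 'f set) \<Rightarrow> ('b, 'f) form \<Rightarrow> ('b, 'f) form" where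
  "horizontal_part X H \<phi> g v = \<phi> g (\<lambda>i. horizontal_proj X H g (v i))"

definition groupoid_form ::
  "('a, 'e::real_normed_vector, 'b, 'f::real_normed_vector) groupoid \<Rightarrow>
   ('b \<Rightarrow> 'f set) \<Rightarrow> nat \<Rightarrow> ('a, 'e) form \<Rightarrow> bool" where
  "groupoid_form X H k \<phi> \<longleftrightarrow>
     differential_form (Obj X) k \<phi> \<and>
     (\<forall>g\<in>points (Arr X).
        horizontal_part X H (pullback (Arr X) (Obj X) (src X) \<phi>) g =
        horizontal_part X H (pullback (Arr X) (Obj X) (tgt X) \<phi>) g)"

end

theory Submission
  imports Defs
begin

text \<open>Through every arrow \<open>\<gamma>\<close> passes an integral manifold \<open>\<iota> : N \<rightarrow> X\<^sub>1\<close> of \<open>\<H>\<close>. On vectors tangent to \<open>N\<close>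
  the projection \<open>P\<^sub>\<H>\<close> is the identity, so the hypothesis on \<open>\<phi>\<close> restricts to
  \<open>(s \<circ> \<iota>)\<^sup>*\<phi> = (t \<circ> \<iota>)\<^sup>*\<phi>\<close> on \<open>N\<close>. As \<open>d\<close> commutes with pullbacks, also
  \<open>(s \<circ> \<iota>)\<^sup>*d\<phi> = (t \<circ> \<iota>)\<^sup>*d\<phi>\<close>, and since \<open>T\<^sub>\<gamma>N = \<H>\<^sub>\<gamma>\<close> this is the claim at \<open>\<gamma>\<close>. Naturality of \<open>d\<close> in
  coordinates is the cancellation of the symmetric second derivative against the alternating form;
  applied to changes of charts it also gives independence of the preferred charts, hence smoothness
  of \<open>d\<phi>\<close>.\<close>

section \<open>Calculus in finite-dimensional normed spaces\<close>

text \<open>The model spaces are not in the class \<^class>\<open>euclidean_space\<close>, so continuity of coordinate functionals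
  has to be derived from the existence of a finite spanning set.\<close>

lemma finite_independent_coeff_bound:
  fixes B :: "'a::real_normed_vector set"
  assumes "finite B" "independent B"
  shows "\<exists>C\<ge>0. \<forall>a. (\<Sum>b\<in>B. \<bar>a b\<bar>) \<le> C * norm (\<Sum>b\<in>B. a b *\<^sub>R b)"
  using assms
proof (induction B)
  case empty
  show ?case by (intro exI[of _ 0]) auto
next
  case (insert c B)
  have ind: "independent B" and cB: "c \<notin> span B"
    using insert.prems insert.hyps by (auto simp: independent_insert)
  obtain C where C: "C \<ge> 0" "\<And>a. (\<Sum>b\<in>B. \<bar>a b\<bar>) \<le> C * norm (\<Sum>b\<in>B. a b *\<^sub>R b)"
    using insert.IH ind by blast
  \<comment> \<open>The induction hypothesis makes \<open>span B\<close> complete, hence closed.\<close>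
  have "\<exists>\<delta>>0. \<forall>x\<in>span B. \<delta> \<le> norm (c + x)"
  proof (rule ccontr)
    assume "\<not> (\<exists>\<delta>>0. \<forall>x\<in>span B. \<delta> \<le> norm (c + x))"
    then have "\<exists>x\<in>span B. norm (c + x) < 1 / Suc n" for n
      by (metis of_nat_0_less_iff zero_less_Suc zero_less_divide_1_iff not_le)
    then have "\<forall>n. \<exists>a. norm (c + (\<Sum>b\<in>B. a b *\<^sub>R b)) < 1 / Suc n"
      using span_finite[OF insert.hyps(1)] by auto
    then obtain a where a: "\<And>n. norm (c + (\<Sum>b\<in>B. a n b *\<^sub>R b)) < 1 / Suc n"
      by metis
    define x where "x n = (\<Sum>b\<in>B. a n b *\<^sub>R b)" for n
    have lim0: "(\<lambda>n. 1 / real (Suc n)) \<longlonglongrightarrow> 0"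
      by (rule LIMSEQ_Suc) (rule lim_1_over_n)
    have xlim: "(\<lambda>n. c + x n) \<longlonglongrightarrow> 0"
      by (rule Lim_null_comparison[OF _ lim0]) (use a in \<open>auto simp: x_def less_imp_le\<close>)
    then have "(\<lambda>n. c + x n - c) \<longlonglongrightarrow> 0 - c" by (intro tendsto_intros)
    then have xl: "x \<longlonglongrightarrow> - c" by simp
    then have cx: "Cauchy x" by (rule LIMSEQ_imp_Cauchy)
    \<comment> \<open>The bound of the induction hypothesis, applied to the differences
      \<open>a m - a n\<close>, transfers the Cauchy property from \<open>x\<close> to each
      coefficient.\<close>
    have "Cauchy (\<lambda>n. a n b)" if b: "b \<in> B" for b
    proof (rule CauchyI)
      fix e :: real assume "e > 0"
      then have "e / (C + 1) > 0" using C(1) by simp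
      then obtain M where M: "\<And>m n. m \<ge> M \<Longrightarrow> n \<ge> M \<Longrightarrow> norm (x m - x n) < e / (C + 1)"
        using CauchyD[OF cx] by metis
      have "norm (a m b - a n b) < e" if "m \<ge> M" "n \<ge> M" for m n
      proof -
        have "\<bar>a m b - a n b\<bar> \<le> (\<Sum>b\<in>B. \<bar>a m b - a n b\<bar>)"
          by (rule member_le_sum[OF b _ insert.hyps(1), where f = "\<lambda>b. \<bar>a m b - a n b\<bar>"]) auto
        also have "\<dots> \<le> C * norm (x m - x n)"
          using C(2)[of "\<lambda>b. a m b - a n b"]
          by (simp add: x_def scaleR_diff_left sum_subtractf)
        also have "\<dots> \<le> (C + 1) * norm (x m - x n)" by (simp add: mult_right_mono)
        also have "\<dots> < e" using M[OF that] C(1) by (simp add: field_simps)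
        finally show ?thesis by simp
      qed
      then show "\<exists>M. \<forall>m\<ge>M. \<forall>n\<ge>M. norm (a m b - a n b) < e" by blast
    qed
    then have "\<forall>b\<in>B. \<exists>l. (\<lambda>n. a n b) \<longlonglongrightarrow> l"
      using Cauchy_convergent_iff convergent_def by blast
    then obtain l where l: "\<And>b. b \<in> B \<Longrightarrow> (\<lambda>n. a n b) \<longlonglongrightarrow> l b" by metis
    have "x \<longlonglongrightarrow> (\<Sum>b\<in>B. l b *\<^sub>R b)"
      unfolding x_def by (intro tendsto_sum tendsto_scaleR l tendsto_const)
    then have "- c = (\<Sum>b\<in>B. l b *\<^sub>R b)" using xl LIMSEQ_unique by blast
    then have "- c \<in> span B" by (simp add: span_sum span_scale span_base)
    then show False using cB span_neg by fastforce
  qed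
  then obtain \<delta> where d: "\<delta> > 0" "\<And>x. x \<in> span B \<Longrightarrow> \<delta> \<le> norm (c + x)" by blast
  show ?case
  proof (intro exI conjI allI)
    \<comment> \<open>The constant adds two estimates: \<open>\<bar>a c\<bar>\<close> is at most
      \<open>norm z / \<delta>\<close>, and the other coefficients contribute at most
      \<open>C * norm y\<close>, where \<open>norm y\<close> is at most
      \<open>norm z * (1 + norm c / \<delta>)\<close>.\<close>
    show "C * (1 + norm c / \<delta>) + 1 / \<delta> \<ge> 0" using C(1) d(1) by simp
    fix a :: "'a \<Rightarrow> real"
    define y where "y = (\<Sum>b\<in>B. a b *\<^sub>R b)"
    define z where "z = a c *\<^sub>R c + y"
    have ys: "y \<in> span B" unfolding y_def by (simp add: span_sum span_scale span_base)
    have ac: "\<bar>a c\<bar> \<le> norm z / \<delta>"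
    proof (cases "a c = 0")
      case False
      have "\<delta> \<le> norm (c + (1 / a c) *\<^sub>R y)" by (rule d(2)) (simp add: ys span_scale)
      also have "c + (1 / a c) *\<^sub>R y = (1 / a c) *\<^sub>R z" using False by (simp add: z_def scaleR_add_right)
      finally show ?thesis using False d(1) by (simp add: field_simps)
    qed (use d(1) in simp)
    have "norm y \<le> norm z + \<bar>a c\<bar> * norm c"
      using norm_triangle_ineq4[of z "a c *\<^sub>R c"] by (simp add: z_def)
    also have "\<dots> \<le> norm z + norm z / \<delta> * norm c"
      by (intro add_left_mono mult_right_mono ac norm_ge_zero)
    finally have "C * norm y \<le> C * (norm z + norm z / \<delta> * norm c)" using C(1) by (rule mult_left_mono)
    moreover have "(\<Sum>b\<in>B. \<bar>a b\<bar>) \<le> C * norm y" using C(2) by (simp add: y_def)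
    ultimately have "\<bar>a c\<bar> + (\<Sum>b\<in>B. \<bar>a b\<bar>) \<le> (C * (1 + norm c / \<delta>) + 1 / \<delta>) * norm z"
      using ac by (simp add: algebra_simps)
    then show "(\<Sum>b\<in>insert c B. \<bar>a b\<bar>) \<le> (C * (1 + norm c / \<delta>) + 1 / \<delta>) * norm (\<Sum>b\<in>insert c B. a b *\<^sub>R b)"
      using insert.hyps by (simp add: z_def y_def)
  qed
qed

text \<open>A basis is extracted from the spanning set and paired with its dual basis. The
  coefficient bound makes the dual functionals continuous, so they can be composed with
  derivatives.\<close>

lemma finite_span_coordinates:
  assumes "\<exists>B :: 'a::real_normed_vector set. finite B \<and> span B = UNIV"
  obtains B :: "'a::real_normed_vector set" and l :: "'a \<Rightarrow> 'a \<Rightarrow> real"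
  where "finite B" "\<And>b. b \<in> B \<Longrightarrow> bounded_linear (l b)" "\<And>x. (\<Sum>b\<in>B. l b x *\<^sub>R b) = x"
proof -
  obtain S :: "'a set" where S: "finite S" "span S = UNIV" using assms by blast
  obtain B where B: "B \<subseteq> S" "independent B" "S \<subseteq> span B"
    using maximal_independent_subset[of S] by blast
  have fin: "finite B" using B(1) S(1) finite_subset by blast
  have sp: "span B = UNIV" using B(3) S(2) by (metis span_mono span_span top.extremum_uniqueI)
  have rep: "(\<Sum>b\<in>B. representation B x b *\<^sub>R b) = x" for x
    using sum_representation_eq[OF B(2) _ fin subset_refl] sp by simp
  obtain C where C: "\<And>a. (\<Sum>b\<in>B. \<bar>a b\<bar>) \<le> C * norm (\<Sum>b\<in>B. a b *\<^sub>R b)"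
    using finite_independent_coeff_bound[OF fin B(2)] by blast
  show ?thesis
  proof (rule that[OF fin _ rep])
    fix b assume b: "b \<in> B"
    show "bounded_linear (\<lambda>x. representation B x b)"
    proof (rule bounded_linear_intro)
      show "representation B (x + y) b = representation B x b + representation B y b" for x y
        using representation_add[OF B(2)] sp by simp
      show "representation B (r *\<^sub>R x) b = r *\<^sub>R representation B x b" for r x
        using representation_scale[OF B(2)] sp by simp
      fix x
      have "\<bar>representation B x b\<bar> \<le> (\<Sum>b\<in>B. \<bar>representation B x b\<bar>)"
        by (rule member_le_sum[OF b _ fin, where f = "\<lambda>b. \<bar>representation B x b\<bar>"]) auto
      also have "\<dots> \<le> C * norm x" using C[of "representation B x"] rep[of x] by simp
      finally show "norm (representation B x b) \<le> norm x * C" by (simp add: mult.commute)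
    qed
  qed
qed

section \<open>Product rule for multilinear forms with moving arguments\<close>

text \<open>Leibniz rule for a form and arguments that all vary with the point. The induction
  releases one slot at a time: entries below \<open>n\<close> move, the others are frozen at
  \<open>c\<close>. Expanding the newly moving entry in coordinates gives a finite sum of scalar
  functions times forms with a fixed basis vector in that slot; the product rule and the induction
  hypothesis apply to each summand.\<close>

lemma multilinear_has_derivative_aux:
  fixes \<Omega> :: "'x::real_normed_vector \<Rightarrow> (nat \<Rightarrow> 'e::real_normed_vector) \<Rightarrow> 'c::real_normed_vector"
  assumes fd: "\<exists>B :: 'e set. finite B \<and> span B = UNIV"
    and U: "open U" "x \<in> U"
    and lin: "\<And>y v i. y \<in> U \<Longrightarrow> i < k \<Longrightarrow> linear (\<lambda>z. \<Omega> y (v(i := z)))"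
    and \<Omega>': "\<And>v. ((\<lambda>y. \<Omega> y v) has_derivative \<Omega>' v) (at x)"
    and V': "\<And>i. i < k \<Longrightarrow> ((\<lambda>y. V y i) has_derivative V' i) (at x)"
    and "n \<le> k"
  shows "((\<lambda>y. \<Omega> y (\<lambda>i. if i < n then V y i else c i)) has_derivative
          (\<lambda>h. \<Omega>' (\<lambda>i. if i < n then V x i else c i) h
             + (\<Sum>m<n. \<Omega> x ((\<lambda>i. if i < n then V x i else c i)(m := V' m h))))) (at x)"
  using \<open>n \<le> k\<close>
proof (induction n arbitrary: c)
  case 0
  then show ?case using \<Omega>' by simp
next
  case (Suc n)
  obtain B :: "'e set" and l where B: "finite B" "\<And>b. b \<in> B \<Longrightarrow> bounded_linear (l b)"
    "\<And>z. (\<Sum>b\<in>B. l b z *\<^sub>R b) = z"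
    by (rule finite_span_coordinates[OF fd]) (rule that)
  have nk: "n < k" using Suc.prems by simp
  \<comment> \<open>Slot \<open>n\<close> holds a vector \<open>b\<close> that can be chosen freely:
    basis vectors for the induction hypothesis, \<open>V y n\<close> for the goal.\<close>
  define W where "W y b i = (if i < n then V y i else (c(n := b)) i)" for y b i
  have expand: "\<Omega> y (v(n := z)) = (\<Sum>b\<in>B. l b z *\<^sub>R \<Omega> y (v(n := b)))" if "y \<in> U" for y v z
  proof -
    have "\<Omega> y (v(n := z)) = \<Omega> y (v(n := (\<Sum>b\<in>B. l b z *\<^sub>R b)))" by (simp add: B(3))
    also have "\<dots> = (\<Sum>b\<in>B. l b z *\<^sub>R \<Omega> y (v(n := b)))"
      using linear_sum[OF lin[OF that nk, of v], of "\<lambda>b. l b z *\<^sub>R b" B]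
        linear_scale[OF lin[OF that nk, of v]] by simp
    finally show ?thesis .
  qed
  \<comment> \<open>Differentiating the expansion of \<open>\<Omega>\<close> and using uniqueness of
    derivatives shows that \<open>\<Omega>'\<close> has the same expansion in slot
    \<open>n\<close>.\<close>
  have expand': "\<Omega>' (v(n := z)) h = (\<Sum>b\<in>B. l b z *\<^sub>R \<Omega>' (v(n := b)) h)" for v z h
  proof -
    have "((\<lambda>y. \<Sum>b\<in>B. l b z *\<^sub>R \<Omega> y (v(n := b))) has_derivative
        (\<lambda>h. \<Sum>b\<in>B. l b z *\<^sub>R \<Omega>' (v(n := b)) h)) (at x)"
      by (intro has_derivative_sum has_derivative_scaleR_right \<Omega>')
    then have "((\<lambda>y. \<Omega> y (v(n := z))) has_derivative
        (\<lambda>h. \<Sum>b\<in>B. l b z *\<^sub>R \<Omega>' (v(n := b)) h)) (at x)"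
      by (rule has_derivative_transform_within_open[OF _ U]) (rule expand[symmetric])
    from has_derivative_unique[OF \<Omega>' this] show ?thesis by (rule fun_cong)
  qed
  have Wupd: "W y b = (W y 0)(n := b)" for y b by (auto simp: W_def)
  have expW: "(\<Sum>b\<in>B. l b z *\<^sub>R \<Omega> y (W y b)) = \<Omega> y (W y z)" if "y \<in> U" for y z
    using expand[OF that, of "W y 0" z] by (simp only: Wupd[symmetric])
  have expW': "(\<Sum>b\<in>B. l b z *\<^sub>R \<Omega>' (W y b) h) = \<Omega>' (W y z) h" for y z h
    using expand'[of "W y 0" z h] by (simp only: Wupd[symmetric])
  have W_Suc: "(\<lambda>i. if i < Suc n then V y i else c i) = W y (V y n)" for y
    by (auto simp: W_def less_Suc_eq)
  have IH: "((\<lambda>y. \<Omega> y (W y b)) has_derivative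
      (\<lambda>h. \<Omega>' (W x b) h + (\<Sum>m<n. \<Omega> x ((W x b)(m := V' m h))))) (at x)" for b
    unfolding W_def[abs_def] by (rule Suc.IH[of "c(n := b)"]) (use nk in simp)
  have dl: "((\<lambda>y. l b (V y n)) has_derivative (\<lambda>h. l b (V' n h))) (at x)" if "b \<in> B" for b
    by (rule bounded_linear.has_derivative[OF B(2)[OF that] V'[OF nk]])
  have "((\<lambda>y. \<Sum>b\<in>B. l b (V y n) *\<^sub>R \<Omega> y (W y b)) has_derivative
      (\<lambda>h. \<Sum>b\<in>B. l b (V x n) *\<^sub>R (\<Omega>' (W x b) h + (\<Sum>m<n. \<Omega> x ((W x b)(m := V' m h))))
          + l b (V' n h) *\<^sub>R \<Omega> x (W x b))) (at x)"
    by (intro has_derivative_sum has_derivative_scaleR dl IH)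
  then have "((\<lambda>y. \<Omega> y (W y (V y n))) has_derivative
      (\<lambda>h. \<Sum>b\<in>B. l b (V x n) *\<^sub>R (\<Omega>' (W x b) h + (\<Sum>m<n. \<Omega> x ((W x b)(m := V' m h))))
          + l b (V' n h) *\<^sub>R \<Omega> x (W x b))) (at x)"
    by (rule has_derivative_transform_within_open[OF _ U]) (rule expW)
  moreover have "(\<Sum>b\<in>B. l b (V x n) *\<^sub>R (\<Omega>' (W x b) h + (\<Sum>m<n. \<Omega> x ((W x b)(m := V' m h))))
          + l b (V' n h) *\<^sub>R \<Omega> x (W x b))
      = \<Omega>' (W x (V x n)) h + (\<Sum>m<Suc n. \<Omega> x ((W x (V x n))(m := V' m h)))" for h
  proof -
    have e1: "(\<Sum>b\<in>B. l b (V x n) *\<^sub>R \<Omega>' (W x b) h) = \<Omega>' (W x (V x n)) h"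
      by (rule expW')
    have e2: "(\<Sum>b\<in>B. l b (V' n h) *\<^sub>R \<Omega> x (W x b)) = \<Omega> x (W x (V' n h))"
      by (rule expW[OF U(2)])
    have e3: "(\<Sum>b\<in>B. l b (V x n) *\<^sub>R \<Omega> x ((W x b)(m := V' m h))) = \<Omega> x ((W x (V x n))(m := V' m h))"
      if "m < n" for m
    proof -
      \<comment> \<open>The slots \<open>m\<close> and \<open>n\<close> differ, so the two updates
        commute and slot \<open>n\<close> can again be expanded.\<close>
      define Z where "Z = (W x 0)(m := V' m h)"
      have upd: "(W x b)(m := V' m h) = Z(n := b)" for b
        using that by (auto simp: W_def Z_def fun_eq_iff)
      show ?thesis unfolding upd by (rule expand[OF U(2), symmetric])
    qed
    have "(\<Sum>b\<in>B. l b (V x n) *\<^sub>R (\<Sum>m<n. \<Omega> x ((W x b)(m := V' m h))))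
        = (\<Sum>m<n. \<Sum>b\<in>B. l b (V x n) *\<^sub>R \<Omega> x ((W x b)(m := V' m h)))"
      unfolding scaleR_sum_right by (rule sum.swap)
    also have "\<dots> = (\<Sum>m<n. \<Omega> x ((W x (V x n))(m := V' m h)))"
      by (rule sum.cong) (auto simp: e3)
    finally have e4: "(\<Sum>b\<in>B. l b (V x n) *\<^sub>R (\<Sum>m<n. \<Omega> x ((W x b)(m := V' m h))))
        = (\<Sum>m<n. \<Omega> x ((W x (V x n))(m := V' m h)))" .
    have "(W x (V x n))(n := V' n h) = W x (V' n h)" by (auto simp: W_def)
    then show ?thesis
      by (simp add: scaleR_add_right sum.distrib e1 e2 e4 del: fun_upd_apply)
  qed
  ultimately show ?case by (simp only: W_Suc)
qed

text \<open>The case \<open>n = k\<close>; by \<open>dep\<close>, entries of \<open>V y\<close> with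
  index at least \<open>k\<close> may be replaced by those of \<open>V x\<close>.\<close>

lemma multilinear_has_derivative:
  fixes \<Omega> :: "'x::real_normed_vector \<Rightarrow> (nat \<Rightarrow> 'e::real_normed_vector) \<Rightarrow> 'c::real_normed_vector"
  assumes fd: "\<exists>B :: 'e set. finite B \<and> span B = UNIV"
    and U: "open U" "x \<in> U"
    and lin: "\<And>y v i. y \<in> U \<Longrightarrow> i < k \<Longrightarrow> linear (\<lambda>z. \<Omega> y (v(i := z)))"
    and dep: "\<And>y v w. y \<in> U \<Longrightarrow> (\<And>i. i < k \<Longrightarrow> v i = w i) \<Longrightarrow> \<Omega> y v = \<Omega> y w"
    and \<Omega>': "\<And>v. ((\<lambda>y. \<Omega> y v) has_derivative \<Omega>' v) (at x)"
    and V': "\<And>i. i < k \<Longrightarrow> ((\<lambda>y. V y i) has_derivative V' i) (at x)"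
  shows "((\<lambda>y. \<Omega> y (V y)) has_derivative
          (\<lambda>h. \<Omega>' (V x) h + (\<Sum>m<k. \<Omega> x ((V x)(m := V' m h))))) (at x)"
proof -
  have *: "(\<lambda>i. if i < k then V x i else V x i) = V x" by auto
  have "((\<lambda>y. \<Omega> y (\<lambda>i. if i < k then V y i else V x i)) has_derivative
          (\<lambda>h. \<Omega>' (\<lambda>i. if i < k then V x i else V x i) h
             + (\<Sum>m<k. \<Omega> x ((\<lambda>i. if i < k then V x i else V x i)(m := V' m h))))) (at x)"
    by (rule multilinear_has_derivative_aux[OF fd U, where k = k])
      (rule lin \<Omega>' V' order_refl; assumption)+
  then have "((\<lambda>y. \<Omega> y (\<lambda>i. if i < k then V y i else V x i)) has_derivative
          (\<lambda>h. \<Omega>' (V x) h + (\<Sum>m<k. \<Omega> x ((V x)(m := V' m h))))) (at x)"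
    unfolding * .
  then show ?thesis
    by (rule has_derivative_transform_within_open[OF _ U]) (auto intro: dep)
qed

section \<open>Symmetry of the second derivative\<close>

text \<open>The second difference over the parallelogram with sides \<open>h *\<^sub>R u\<close> and
  \<open>h *\<^sub>R v\<close> is the increment along \<open>u\<close> of the function
  \<open>f (y + h *\<^sub>R v) - f y\<close> of \<open>y\<close>. The mean value inequality reduces
  its estimate to derivatives along \<open>u\<close>, and these are controlled to first order by
  \<open>A\<close>.\<close>

lemma second_difference_estimate:
  fixes f :: "'a::real_normed_vector \<Rightarrow> 'b::real_normed_vector"
  assumes S: "open S" "x \<in> S"
    and f': "\<And>y. y \<in> S \<Longrightarrow> (f has_derivative f' y) (at y)"
    and A': "((\<lambda>y. f' y u) has_derivative A) (at x)"
    and e: "e > 0"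
  shows "\<exists>d>0. \<forall>h. 0 < h \<and> h < d \<longrightarrow>
    norm (f (x + h *\<^sub>R u + h *\<^sub>R v) - f (x + h *\<^sub>R u) - f (x + h *\<^sub>R v) + f x - (h * h) *\<^sub>R A v) \<le> e * (h * h)"
proof -
  \<comment> \<open>For \<open>h * K\<close> below both radii, all points in question are close
    enough to \<open>x\<close>. The factor 2 absorbs two remainder terms, and the summand 1 keeps
    \<open>K\<close> positive if \<open>u\<close> and \<open>v\<close> vanish.\<close>
  define K where "K = 2 * (norm u + norm v) + 1"
  have K: "K > 0" by (simp add: K_def add_nonneg_pos)
  have eK: "e / K > 0" using e K by simp
  have bl: "bounded_linear A" using A' has_derivative_bounded_linear by blast
  interpret A: bounded_linear A by (rule bl)
  obtain d1 where d1: "d1 > 0"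
    "\<And>y. norm (y - x) < d1 \<Longrightarrow> norm (f' y u - f' x u - A (y - x)) \<le> e / K * norm (y - x)"
    using A' eK unfolding has_derivative_at_alt by blast
  obtain d2 where d2: "d2 > 0" "\<And>y. dist y x < d2 \<Longrightarrow> y \<in> S"
    using S unfolding open_dist by blast
  define d where "d = min d1 d2 / K"
  have d: "d > 0" using d1 d2 K by (simp add: d_def)
  show ?thesis
  proof (intro exI[of _ d] conjI allI impI d)
    fix h :: real assume h: "0 < h \<and> h < d"
    have hK: "h * K < d1" "h * K < d2" using h K by (auto simp: d_def field_simps)
    have n1: "norm (\<tau> *\<^sub>R u) \<le> h * norm u" if "\<tau> \<in> {0..h}" for \<tau>
      using that h by (auto intro!: mult_right_mono)
    have near: "norm (\<tau> *\<^sub>R u + h *\<^sub>R v) \<le> h * (norm u + norm v)" "norm (\<tau> *\<^sub>R u) \<le> h * (norm u + norm v)"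
      if "\<tau> \<in> {0..h}" for \<tau>
    proof -
      have "norm (\<tau> *\<^sub>R u + h *\<^sub>R v) \<le> norm (\<tau> *\<^sub>R u) + norm (h *\<^sub>R v)" by (rule norm_triangle_ineq)
      also have "\<dots> \<le> h * norm u + h * norm v" using n1[OF that] h by simp
      finally show "norm (\<tau> *\<^sub>R u + h *\<^sub>R v) \<le> h * (norm u + norm v)" by (simp add: algebra_simps)
      show "norm (\<tau> *\<^sub>R u) \<le> h * (norm u + norm v)"
        using n1[OF that] h by (simp add: algebra_simps add_increasing2)
    qed
    have le: "h * (norm u + norm v) < h * K" using h
      by (intro mult_strict_left_mono) (auto simp: K_def add_nonneg_pos intro: add_strict_increasing2)
    \<comment> \<open>The linear term is subtracted so that \<open>g h - g 0\<close> is exactly the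
      expression to be bounded; it remains to bound the derivative of \<open>g\<close> by
      \<open>e * h\<close>.\<close>
    define g where "g \<tau> = f (x + \<tau> *\<^sub>R u + h *\<^sub>R v) - f (x + \<tau> *\<^sub>R u) - (\<tau> * h) *\<^sub>R A v" for \<tau>
    have mem: "x + \<tau> *\<^sub>R u + h *\<^sub>R v \<in> S" "x + \<tau> *\<^sub>R u \<in> S" if "\<tau> \<in> {0..h}" for \<tau>
      using near[OF that] le hK by (auto intro!: d2(2) simp: dist_norm add.assoc)
    have g': "(g has_derivative (\<lambda>r. f' (x + \<tau> *\<^sub>R u + h *\<^sub>R v) (r *\<^sub>R u) - f' (x + \<tau> *\<^sub>R u) (r *\<^sub>R u) - (r * h) *\<^sub>R A v))
        (at \<tau> within {0..h})" if "\<tau> \<in> {0..h}" for \<tau>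
    proof -
      have a: "((\<lambda>\<tau>. f (x + \<tau> *\<^sub>R u + h *\<^sub>R v)) has_derivative (\<lambda>r. f' (x + \<tau> *\<^sub>R u + h *\<^sub>R v) (r *\<^sub>R u))) (at \<tau> within {0..h})"
        by (rule has_derivative_compose[where g = f and f = "\<lambda>\<tau>. x + \<tau> *\<^sub>R u + h *\<^sub>R v", OF _ f'[OF mem(1)[OF that]]]) (auto intro!: derivative_eq_intros)
      have b: "((\<lambda>\<tau>. f (x + \<tau> *\<^sub>R u)) has_derivative (\<lambda>r. f' (x + \<tau> *\<^sub>R u) (r *\<^sub>R u))) (at \<tau> within {0..h})"
        by (rule has_derivative_compose[where g = f and f = "\<lambda>\<tau>. x + \<tau> *\<^sub>R u", OF _ f'[OF mem(2)[OF that]]]) (auto intro!: derivative_eq_intros)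
      show ?thesis unfolding g_def
        by (rule has_derivative_diff[OF has_derivative_diff[OF a b]]) (auto intro!: derivative_eq_intros)
    qed
    have on: "onorm (\<lambda>r. f' (x + \<tau> *\<^sub>R u + h *\<^sub>R v) (r *\<^sub>R u) - f' (x + \<tau> *\<^sub>R u) (r *\<^sub>R u) - (r * h) *\<^sub>R A v) \<le> e * h"
      if t: "\<tau> \<in> {0..h}" for \<tau>
    proof (rule onorm_le)
      fix r :: real
      have l1: "linear (f' (x + \<tau> *\<^sub>R u + h *\<^sub>R v))" "linear (f' (x + \<tau> *\<^sub>R u))"
        using f' mem[OF t] has_derivative_linear by blast+
      \<comment> \<open>\<open>R\<close> is the first-order remainder of the derivative along
        \<open>u\<close>. In the difference of its values at the two points the linear parts combine
        to \<open>h *\<^sub>R A v\<close>.\<close>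
      define R where "R y = f' y u - f' x u - A (y - x)" for y
      have "f' (x + \<tau> *\<^sub>R u + h *\<^sub>R v) (r *\<^sub>R u) - f' (x + \<tau> *\<^sub>R u) (r *\<^sub>R u) - (r * h) *\<^sub>R A v
          = r *\<^sub>R (f' (x + \<tau> *\<^sub>R u + h *\<^sub>R v) u - f' (x + \<tau> *\<^sub>R u) u - h *\<^sub>R A v)"
        using l1 by (simp add: linear_scale algebra_simps)
      also have "\<dots> = r *\<^sub>R (R (x + \<tau> *\<^sub>R u + h *\<^sub>R v) - R (x + \<tau> *\<^sub>R u))"
        by (simp add: R_def A.add A.scaleR A.diff algebra_simps)
      finally have eq: "f' (x + \<tau> *\<^sub>R u + h *\<^sub>R v) (r *\<^sub>R u) - f' (x + \<tau> *\<^sub>R u) (r *\<^sub>R u) - (r * h) *\<^sub>R A v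
          = r *\<^sub>R (R (x + \<tau> *\<^sub>R u + h *\<^sub>R v) - R (x + \<tau> *\<^sub>R u))" .
      have tri: "norm (p - q) \<le> 2 * E" if "norm p \<le> E" "norm q \<le> E" for p q :: 'b and E
        using norm_triangle_ineq4[of p q] that by linarith
      have R: "norm (R (x + z)) \<le> e / K * (h * (norm u + norm v))" if "norm z \<le> h * (norm u + norm v)" for z
      proof -
        have "norm (R (x + z)) \<le> e / K * norm z"
          unfolding R_def using d1(2)[of "x + z"] that le hK by simp
        also have "\<dots> \<le> e / K * (h * (norm u + norm v))" using that eK by (intro mult_left_mono) auto
        finally show ?thesis .
      qed
      have "norm (R (x + \<tau> *\<^sub>R u + h *\<^sub>R v) - R (x + \<tau> *\<^sub>R u)) \<le> 2 * (e / K * (h * (norm u + norm v)))"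
        using tri[OF R[OF near(1)[OF t]] R[OF near(2)[OF t]]] by (simp only: add.assoc)
      also have "\<dots> = e / K * (h * (2 * (norm u + norm v)))" by simp
      also have "\<dots> \<le> e / K * (h * K)"
        using eK h by (intro mult_left_mono) (auto simp: K_def)
      also have "\<dots> = e * h" using K by simp
      finally show "norm (f' (x + \<tau> *\<^sub>R u + h *\<^sub>R v) (r *\<^sub>R u) - f' (x + \<tau> *\<^sub>R u) (r *\<^sub>R u) - (r * h) *\<^sub>R A v)
          \<le> e * h * norm r"
        unfolding eq by (simp add: mult.commute mult_left_mono)
    qed
    have "norm (g h - g 0) \<le> e * h * norm (h - 0)"
      by (rule differentiable_bound[OF _ g' on]) (use h in auto)
    moreover have "g h - g 0 = f (x + h *\<^sub>R u + h *\<^sub>R v) - f (x + h *\<^sub>R u) - f (x + h *\<^sub>R v) + f x - (h * h) *\<^sub>R A v"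
      by (simp add: g_def)
    ultimately show "norm (f (x + h *\<^sub>R u + h *\<^sub>R v) - f (x + h *\<^sub>R u) - f (x + h *\<^sub>R v) + f x - (h * h) *\<^sub>R A v) \<le> e * (h * h)"
      using h by (simp add: mult.assoc)
  qed
qed

text \<open>Interchanging \<open>u\<close> and \<open>v\<close> leaves the second difference
  unchanged, so it is approximated by both \<open>(h * h) *\<^sub>R A v\<close> and
  \<open>(h * h) *\<^sub>R B u\<close>.\<close>

lemma second_derivative_symmetric:
  fixes f :: "'a::real_normed_vector \<Rightarrow> 'b::real_normed_vector"
  assumes S: "open S" "x \<in> S"
    and f': "\<And>y. y \<in> S \<Longrightarrow> (f has_derivative f' y) (at y)"
    and A: "((\<lambda>y. f' y u) has_derivative A) (at x)"
    and B: "((\<lambda>y. f' y v) has_derivative B) (at x)"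
  shows "A v = B u"
proof (rule ccontr)
  assume "A v \<noteq> B u"
  \<comment> \<open>With a third of the distance, the two approximation errors together stay
    strictly below the distance.\<close>
  define e where "e = norm (A v - B u) / 3"
  have e: "e > 0" using \<open>A v \<noteq> B u\<close> by (simp add: e_def)
  obtain d1 where d1: "d1 > 0" "\<And>h. 0 < h \<Longrightarrow> h < d1 \<Longrightarrow>
    norm (f (x + h *\<^sub>R u + h *\<^sub>R v) - f (x + h *\<^sub>R u) - f (x + h *\<^sub>R v) + f x - (h * h) *\<^sub>R A v) \<le> e * (h * h)"
    using second_difference_estimate[OF S f' A e] by blast
  obtain d2 where d2: "d2 > 0" "\<And>h. 0 < h \<Longrightarrow> h < d2 \<Longrightarrow>
    norm (f (x + h *\<^sub>R v + h *\<^sub>R u) - f (x + h *\<^sub>R v) - f (x + h *\<^sub>R u) + f x - (h * h) *\<^sub>R B u) \<le> e * (h * h)"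
    using second_difference_estimate[OF S f' B e] by blast
  define h where "h = min d1 d2 / 2"
  have h: "0 < h" "h < d1" "h < d2" using d1 d2 by (auto simp: h_def)
  define \<Delta> where "\<Delta> = f (x + h *\<^sub>R u + h *\<^sub>R v) - f (x + h *\<^sub>R u) - f (x + h *\<^sub>R v) + f x"
  have 1: "norm (\<Delta> - (h * h) *\<^sub>R A v) \<le> e * (h * h)" using d1(2)[OF h(1,2)] by (simp add: \<Delta>_def)
  have "\<Delta> = f (x + h *\<^sub>R v + h *\<^sub>R u) - f (x + h *\<^sub>R v) - f (x + h *\<^sub>R u) + f x"
    by (simp add: \<Delta>_def algebra_simps)
  then have 2: "norm (\<Delta> - (h * h) *\<^sub>R B u) \<le> e * (h * h)" using d2(2)[OF h(1,3)] by simp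
  have "norm ((h * h) *\<^sub>R (A v - B u)) \<le> 2 * e * (h * h)"
    using norm_triangle_ineq4[of "\<Delta> - (h * h) *\<^sub>R B u" "\<Delta> - (h * h) *\<^sub>R A v"] 1 2
    by (simp add: algebra_simps)
  then have "norm (A v - B u) \<le> 2 * e" using h by simp
  then show False using e by (simp add: e_def)
qed


section \<open>Exterior derivative in coordinates\<close>

definition omit :: "nat \<Rightarrow> (nat \<Rightarrow> 'a) \<Rightarrow> nat \<Rightarrow> 'a" where
  "omit i v = (\<lambda>j. if j < i then v j else v (Suc j))"

lemma omit_upd_same [simp]: "omit i (v(i := z)) = omit i v"
  by (auto simp: omit_def fun_eq_iff)

lemma omit_upd:
  assumes "m \<noteq> i"
  shows "omit i (v(m := z)) = (omit i v)((if m < i then m else m - 1) := z)"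
  using assms by (auto simp: omit_def fun_eq_iff)

lemma local_ext_deriv_omit:
  "local_ext_deriv k \<omega> x v = (\<Sum>i\<le>k. (-1) ^ i * frechet_derivative (\<lambda>y. \<omega> y (omit i v)) (at x) (v i))"
  by (simp add: local_ext_deriv_def omit_def)

text \<open>The slots of a sequence with entry \<open>i\<close> omitted correspond to the indices
  other than \<open>i\<close> by the increasing bijection.\<close>

lemma sum_omit:
  fixes g :: "nat \<Rightarrow> 'a::comm_monoid_add"
  assumes "i \<le> k"
  shows "(\<Sum>m<k. g (if m < i then m else Suc m)) = (\<Sum>m\<in>{..k} - {i}. g m)"
  by (rule sum.reindex_bij_witness[of _ "\<lambda>m. if m < i then m else m - 1" "\<lambda>m. if m < i then m else Suc m"])
    (use assms in \<open>auto split: if_splits\<close>)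

lemma alternating_formD:
  assumes "alternating_form k \<omega>"
  shows "(\<And>i. i < k \<Longrightarrow> v i = w i) \<Longrightarrow> \<omega> v = \<omega> w"
    and "i < k \<Longrightarrow> linear (\<lambda>x. \<omega> (v(i := x)))"
    and "i < k \<Longrightarrow> j < k \<Longrightarrow> i \<noteq> j \<Longrightarrow> v i = v j \<Longrightarrow> \<omega> v = 0"
proof -
  note \<omega> = assms[unfolded alternating_form_def]
  show "(\<And>i. i < k \<Longrightarrow> v i = w i) \<Longrightarrow> \<omega> v = \<omega> w"
    using \<omega>[THEN conjunct1] by simp
  show "i < k \<Longrightarrow> linear (\<lambda>x. \<omega> (v(i := x)))"
    using \<omega>[THEN conjunct2, THEN conjunct1] by simp
  show "i < k \<Longrightarrow> j < k \<Longrightarrow> i \<noteq> j \<Longrightarrow> v i = v j \<Longrightarrow> \<omega> v = 0"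
    using \<omega>[THEN conjunct2, THEN conjunct2] by simp
qed

text \<open>Polarization: the form vanishes on the diagonal, and the diagonal value at
  \<open>a + b\<close> expands into the two mixed terms.\<close>

lemma alternating_form_swap:
  assumes \<omega>: "alternating_form k \<omega>" and ij: "i < k" "j < k" "i \<noteq> j"
  shows "\<omega> (v(i := a, j := b)) = - \<omega> (v(i := b, j := a))"
proof -
  define f where "f a b = \<omega> (v(i := a, j := b))" for a b
  have l2: "linear (f a)" for a
    using alternating_formD(2)[OF \<omega> ij(2), of "v(i := a)"] by (simp add: f_def[abs_def])
  have l1: "linear (\<lambda>a. f a b)" for b
    using alternating_formD(2)[OF \<omega> ij(1), of "v(j := b)"] ij(3)
    by (simp add: f_def fun_upd_twist)
  have 0: "f c c = 0" for c
    unfolding f_def by (rule alternating_formD(3)[OF \<omega> ij]) (use ij in auto)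
  have "0 = f (a + b) (a + b)" by (simp add: 0)
  also have "\<dots> = f a a + f a b + f b a + f b b"
    using linear_add[OF l2] linear_add[OF l1] by simp
  finally show ?thesis by (simp add: 0 f_def[symmetric])
qed

text \<open>The two shortened sequences differ by moving one entry across \<open>b - a - 1\<close>
  places, which gives just the sign that makes the terms cancel. It serves twice: for the
  alternation of the exterior derivative and for the cancellation of second derivatives.\<close>

lemma alternating_form_omit_cancel:
  assumes \<omega>: "alternating_form k \<omega>" and "w a = w b" "a < b" "b \<le> k"
  shows "(-1) ^ a * \<omega> (omit a w) + (-1) ^ b * \<omega> (omit b w) = 0"
  using assms(2-)
proof (induction b arbitrary: w)
  case 0
  then show ?case by simp
next
  case (Suc b)
  show ?case
  proof (cases "a = b")
    case True
    then have "omit a w = omit (Suc b) w"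
      using Suc.prems by (auto simp: omit_def fun_eq_iff less_Suc_eq)
    then show ?thesis using True by simp
  next
    case False
    then have ab: "a < b" using Suc.prems by simp
    \<comment> \<open>Transposing two neighbours moves the repeated value from \<open>Suc b\<close>
      to \<open>b\<close>, where the induction hypothesis applies. Omitting \<open>b\<close>
      afterwards yields \<open>omit (Suc b) w\<close>, while omitting \<open>a\<close> leaves a
      transposition and hence a sign.\<close>
    define w' where "w' = w(b := w (Suc b), Suc b := w b)"
    have IH: "(-1) ^ a * \<omega> (omit a w') + (-1) ^ b * \<omega> (omit b w') = 0"
      by (rule Suc.IH) (use Suc.prems ab in \<open>auto simp: w'_def\<close>)
    have 1: "omit b w' = omit (Suc b) w"
      by (auto simp: omit_def w'_def fun_eq_iff less_Suc_eq)
    have 2: "omit a w' = (omit a w)(b - 1 := w (Suc b), b := w b)"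
      using ab by (auto simp: omit_def w'_def fun_eq_iff)
    have 3: "omit a w = (omit a w)(b - 1 := w b, b := w (Suc b))"
      using ab by (auto simp: omit_def fun_eq_iff)
    have "\<omega> (omit a w') = - \<omega> ((omit a w)(b - 1 := w b, b := w (Suc b)))"
      unfolding 2 by (rule alternating_form_swap[OF \<omega>]) (use ab Suc.prems in auto)
    then have "\<omega> (omit a w') = - \<omega> (omit a w)" using 3 by simp
    then show ?thesis using IH by (simp add: 1)
  qed
qed

text \<open>The algebra behind the alternation of the exterior derivative, with \<open>A v h\<close>
  standing for the derivative in direction \<open>h\<close> of the form evaluated at
  \<open>v\<close>.\<close>

lemma alternating_form_antisymmetrize:
  fixes A :: "(nat \<Rightarrow> 'e::real_vector) \<Rightarrow> 'e \<Rightarrow> real"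
  assumes alt: "\<And>h. alternating_form k (\<lambda>v. A v h)" and lin: "\<And>v. linear (A v)"
  shows "alternating_form (Suc k) (\<lambda>v. \<Sum>i\<le>k. (-1) ^ i * A (omit i v) (v i))"
  unfolding alternating_form_def
proof (intro conjI allI impI)
  fix v w :: "nat \<Rightarrow> 'e" assume "\<forall>i<Suc k. v i = w i"
  then show "(\<Sum>i\<le>k. (-1) ^ i * A (omit i v) (v i)) = (\<Sum>i\<le>k. (-1) ^ i * A (omit i w) (w i))"
    by (intro sum.cong refl arg_cong2[where f = "(*)"])
      (auto simp: omit_def intro!: alternating_formD(1)[OF alt])
next
  fix v :: "nat \<Rightarrow> 'e" and m assume m: "m < Suc k"
  have "linear (\<lambda>x. A (omit i (v(m := x))) ((v(m := x)) i))" if i: "i \<le> k" for i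
  proof (cases "i = m")
    case False
    have "linear (\<lambda>x. A ((omit i v)((if m < i then m else m - 1) := x)) (v i))"
      by (rule alternating_formD(2)[OF alt]) (use False i m in auto)
    then show ?thesis using False by (simp add: omit_upd)
  qed (use lin in \<open>simp add: eta_contract_eq\<close>)
  then have "linear (\<lambda>x. \<Sum>i\<in>{..k}. (-1) ^ i *\<^sub>R A (omit i (v(m := x))) ((v(m := x)) i))"
    by (intro linear_compose_sum ballI linear_compose_scale_right) auto
  then show "linear (\<lambda>x. \<Sum>i\<le>k. (-1) ^ i * A (omit i (v(m := x))) ((v(m := x)) i))"
    by simp
next
  have main: "(\<Sum>i\<le>k. (-1) ^ i * A (omit i v) (v i)) = 0"
    if ab: "a < b" "b \<le> k" and v: "v a = v b" for a b and v :: "nat \<Rightarrow> 'e"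
  proof -
    \<comment> \<open>If neither of the equal entries is omitted, both survive, possibly shifted
      down by one place.\<close>
    have zero: "A (omit i v) (v i) = 0" if i: "i \<le> k" "i \<noteq> a" "i \<noteq> b" for i
      by (rule alternating_formD(3)[OF alt, where i = "if a < i then a else a - 1" and j = "if b < i then b else b - 1"])
        (use i ab v in \<open>auto simp: omit_def\<close>)
    have "(\<Sum>i\<le>k. (-1) ^ i * A (omit i v) (v i)) = (\<Sum>i\<in>{a, b}. (-1) ^ i * A (omit i v) (v i))"
      by (rule sum.mono_neutral_right) (use ab zero in auto)
    also have "\<dots> = 0"
      using alternating_form_omit_cancel[OF alt v ab, of "v b"] ab v by simp
    finally show ?thesis .
  qed
  fix v :: "nat \<Rightarrow> 'e" and a b assume "a < Suc k" "b < Suc k" "a \<noteq> b \<and> v a = v b"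
  then show "(\<Sum>i\<le>k. (-1) ^ i * A (omit i v) (v i)) = 0"
    using main[of a b v] main[of b a v] by (cases "a < b") auto
qed

section \<open>Exterior derivatives of families of alternating forms\<close>

text \<open>Each axiom is an identity between functions on \<open>S\<close>; differentiating both
  sides and using uniqueness of derivatives carries it over to the derivative.\<close>

lemma alternating_form_derivative:
  fixes \<omega> :: "'a::real_normed_vector \<Rightarrow> (nat \<Rightarrow> 'b::real_vector) \<Rightarrow> real"
  assumes S: "open S" "x \<in> S" and alt: "\<And>y. y \<in> S \<Longrightarrow> alternating_form k (\<omega> y)"
    and d: "\<And>v. ((\<lambda>y. \<omega> y v) has_derivative \<omega>' v) (at x)"
  shows "alternating_form k (\<lambda>v. \<omega>' v h)"
proof -
  have eqI: "\<omega>' v h = f' h" if "\<And>y. y \<in> S \<Longrightarrow> \<omega> y v = f y" "(f has_derivative f') (at x)" for v f f'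
  proof -
    have "((\<lambda>y. \<omega> y v) has_derivative f') (at x)"
      by (rule has_derivative_transform_within_open[OF that(2) S]) (simp add: that(1))
    from has_derivative_unique[OF d this] show ?thesis by simp
  qed
  show ?thesis
    unfolding alternating_form_def
  proof (intro conjI allI impI)
    fix v w :: "nat \<Rightarrow> 'b" assume "\<forall>i<k. v i = w i"
    then show "\<omega>' v h = \<omega>' w h" by (intro eqI[OF _ d] alternating_formD(1)[OF alt]) auto
  next
    fix v :: "nat \<Rightarrow> 'b" and i assume i: "i < k"
    note l = alternating_formD(2)[OF alt i, of _ v]
    show "linear (\<lambda>z. \<omega>' (v(i := z)) h)"
    proof (rule linearI)
      show "\<omega>' (v(i := a + b)) h = \<omega>' (v(i := a)) h + \<omega>' (v(i := b)) h" for a b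
        by (rule eqI[OF _ has_derivative_add[OF d d]]) (rule linear_add[OF l])
      show "\<omega>' (v(i := r *\<^sub>R a)) h = r *\<^sub>R \<omega>' (v(i := a)) h" for r a
        by (rule eqI[OF _ has_derivative_scaleR_right[OF d]]) (rule linear_scale[OF l])
    qed
  next
    fix v :: "nat \<Rightarrow> 'b" and i j assume "i < k" "j < k" "i \<noteq> j \<and> v i = v j"
    then have "\<omega> y v = 0" if "y \<in> S" for y
      using alternating_formD(3)[OF alt[OF that], of i j v] by simp
    then show "\<omega>' v h = 0"
      by (rule eqI[OF _ has_derivative_const])
  qed
qed

lemma alternating_form_local_ext_deriv:
  assumes S: "open S" "x \<in> S" and alt: "\<And>y. y \<in> S \<Longrightarrow> alternating_form k (\<omega> y)"
    and d: "\<And>v. (\<lambda>y. \<omega> y v) differentiable (at x)"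
  shows "alternating_form (Suc k) (local_ext_deriv k \<omega> x)"
proof -
  define A where "A v = frechet_derivative (\<lambda>y. \<omega> y v) (at x)" for v
  have A: "((\<lambda>y. \<omega> y v) has_derivative A v) (at x)" for v
    using d frechet_derivative_works unfolding A_def by blast
  have "alternating_form (Suc k) (\<lambda>v. \<Sum>i\<le>k. (-1) ^ i * A (omit i v) (v i))"
    by (rule alternating_form_antisymmetrize[OF alternating_form_derivative[OF S alt A] has_derivative_linear[OF A]])
  then show ?thesis by (simp add: local_ext_deriv_omit[abs_def] A_def)
qed

text \<open>Locality. \<open>frechet_derivative\<close> chooses among all derivatives, and both
  families have the same ones at \<open>x\<close>, so the chosen values agree even at points where
  no derivative exists.\<close>

lemma local_ext_deriv_cong:
  assumes "open S" "x \<in> S" "\<And>y v. y \<in> S \<Longrightarrow> \<omega> y v = \<eta> y v"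
  shows "local_ext_deriv k \<omega> x v = local_ext_deriv k \<eta> x v"
proof -
  have "((\<lambda>y. \<omega> y w) has_derivative D) (at x) \<longleftrightarrow> ((\<lambda>y. \<eta> y w) has_derivative D) (at x)" for w D
    using has_derivative_transform_within_open[where f = "\<lambda>y. \<omega> y w", OF _ assms(1,2)]
      has_derivative_transform_within_open[where f = "\<lambda>y. \<eta> y w", OF _ assms(1,2)] assms(3)
    by (metis (no_types, lifting))
  then show ?thesis by (simp add: local_ext_deriv_omit frechet_derivative_def)
qed

text \<open>The terms with a second derivative are indexed by pairs \<open>(i, m)\<close>; those of \<open>(i, m)\<close> and \<open>(m, i)\<close> cancel by
  \<open>alternating_form_omit_cancel\<close>.\<close>

lemma local_ext_deriv_pullback:
  fixes F :: "'e::real_normed_vector \<Rightarrow> 'f::real_normed_vector"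
  assumes fd: "\<exists>B :: 'f set. finite B \<and> span B = UNIV"
    and S: "open S" "x \<in> S"
    and F': "\<And>y. y \<in> S \<Longrightarrow> (F has_derivative F' y) (at y)"
    and F'': "\<And>u. ((\<lambda>y. F' y u) has_derivative F'' u) (at x)"
    and alt: "\<And>y. y \<in> S \<Longrightarrow> alternating_form k (\<omega> (F y))"
    and d: "\<And>v. (\<lambda>z. \<omega> z v) differentiable (at (F x))"
  shows "local_ext_deriv k (\<lambda>y v. \<omega> (F y) (\<lambda>i. F' y (v i))) x v
    = local_ext_deriv k \<omega> (F x) (\<lambda>i. F' x (v i))"
proof -
  define \<omega>' where "\<omega>' v = frechet_derivative (\<lambda>z. \<omega> z v) (at (F x))" for v
  have \<omega>': "((\<lambda>z. \<omega> z v) has_derivative \<omega>' v) (at (F x))" for v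
    using d frechet_derivative_works unfolding \<omega>'_def by blast
  define w where "w i = F' x (v i)" for i
  define u where "u i m = F'' (v m) (v i)" for i m
  have usym: "u i m = u m i" for i m
    unfolding u_def by (rule second_derivative_symmetric[OF S F' F'' F''])
  have D: "((\<lambda>y. \<omega> (F y) (\<lambda>j. F' y (omit i v j))) has_derivative
      (\<lambda>h. \<omega>' (\<lambda>j. F' x (omit i v j)) (F' x h)
         + (\<Sum>m<k. \<omega> (F x) ((\<lambda>j. F' x (omit i v j))(m := F'' (omit i v m) h))))) (at x)" for i
    by (rule multilinear_has_derivative[OF fd S, where \<Omega> = "\<lambda>y. \<omega> (F y)" and \<Omega>' = "\<lambda>v h. \<omega>' v (F' x h)"
          and V = "\<lambda>y j. F' y (omit i v j)" and V' = "\<lambda>j. F'' (omit i v j)"])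
      (auto intro: alternating_formD(1,2)[OF alt] F'' has_derivative_compose[OF F'[OF S(2)] \<omega>'])
  have om: "(\<lambda>j. F' x (omit i v j)) = omit i w" for i by (auto simp: omit_def w_def fun_eq_iff)
  \<comment> \<open>Entry \<open>i\<close> is set to \<open>u i m\<close> as well, although
    \<open>omit i\<close> deletes it: the sequence then has equal entries at \<open>i\<close> and
    \<open>m\<close> and is symmetric in the two indices, as the cancellation requires. The diagonal
    is set to 0 so that sums may run over all pairs.\<close>
  define c where "c i m = (if i = m then 0 else (-1) ^ i * \<omega> (F x) (omit i (w(i := u i m, m := u i m))))" for i m
  have antisym: "c i m = - c m i" if "i \<le> k" "m \<le> k" for i m
  proof -
    have lt: "c a b = - c b a" if "a < b" "b \<le> k" for a b
      using alternating_form_omit_cancel[OF alt[OF S(2)], of "w(a := u a b, b := u a b)" a b] that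
      by (simp add: c_def usym[of b a] fun_upd_twist[of b a])
    show ?thesis using lt[of i m] lt[of m i] that
      by (cases i m rule: linorder_cases) (auto simp: c_def)
  qed
  have inner: "(-1) ^ i * (\<Sum>m<k. \<omega> (F x) ((omit i w)(m := F'' (omit i v m) (v i)))) = (\<Sum>m\<le>k. c i m)"
    if i: "i \<le> k" for i
  proof -
    have "(-1) ^ i * (\<Sum>m<k. \<omega> (F x) ((omit i w)(m := F'' (omit i v m) (v i))))
        = (\<Sum>m<k. c i (if m < i then m else Suc m))"
      unfolding sum_distrib_left
    proof (rule sum.cong[OF refl])
      fix m
      \<comment> \<open>Slot \<open>m\<close> of \<open>omit i v\<close> holds the entry of
        \<open>v\<close> with index \<open>n\<close>.\<close>
      define n where "n = (if m < i then m else Suc m)"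
      have n: "n \<noteq> i" "(if n < i then n else n - 1) = m" by (auto simp: n_def)
      have "omit i (w(i := u i n, n := u i n)) = (omit i w)(m := u i n)"
        using omit_upd[OF n(1), of "w(i := u i n)"] by (simp only: n(2) omit_upd_same)
      moreover have "F'' (omit i v m) (v i) = u i n" by (simp add: omit_def u_def n_def)
      ultimately show "(-1) ^ i * \<omega> (F x) ((omit i w)(m := F'' (omit i v m) (v i)))
          = c i (if m < i then m else Suc m)"
        unfolding n_def[symmetric] using n(1) by (simp add: c_def)
    qed
    also have "\<dots> = (\<Sum>m\<in>{..k} - {i}. c i m)" by (rule sum_omit[OF i])
    also have "\<dots> = (\<Sum>m\<le>k. c i m)"
      by (rule sum.mono_neutral_left) (auto simp: c_def)
    finally show ?thesis .
  qed
  have "(\<Sum>i\<le>k. \<Sum>m\<le>k. c i m) = (\<Sum>m\<le>k. \<Sum>i\<le>k. c i m)" by (rule sum.swap)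
  also have "\<dots> = (\<Sum>m\<le>k. \<Sum>i\<le>k. - c m i)"
    by (intro sum.cong refl antisym) auto
  finally have zero: "(\<Sum>i\<le>k. \<Sum>m\<le>k. c i m) = 0" by (simp add: sum_negf)
  have "local_ext_deriv k (\<lambda>y v. \<omega> (F y) (\<lambda>i. F' y (v i))) x v
      = (\<Sum>i\<le>k. (-1) ^ i * (\<omega>' (omit i w) (w i)
          + (\<Sum>m<k. \<omega> (F x) ((omit i w)(m := F'' (omit i v m) (v i))))))"
    unfolding local_ext_deriv_omit frechet_derivative_at[OF D, symmetric] om w_def[symmetric] ..
  also have "\<dots> = (\<Sum>i\<le>k. (-1) ^ i * \<omega>' (omit i w) (w i)) + (\<Sum>i\<le>k. \<Sum>m\<le>k. c i m)"
    by (simp add: distrib_left sum.distrib inner)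
  also have "\<dots> = local_ext_deriv k \<omega> (F x) w"
    by (simp add: zero local_ext_deriv_omit \<omega>'_def)
  finally show ?thesis unfolding w_def .
qed

section \<open>Smoothness of the exterior derivative in coordinates\<close>

lemma Ck_on_cong:
  assumes "open S" "\<And>x. x \<in> S \<Longrightarrow> f x = g x" "Ck_on k S f"
  shows "Ck_on k S g"
  using assms(2,3)
proof (induction k arbitrary: f g)
  case 0
  then show ?case by (simp cong: continuous_on_cong)
next
  case (Suc k)
  have d: "(g has_derivative frechet_derivative f (at x)) (at x)" if "x \<in> S" for x
    by (rule has_derivative_transform_within_open[where f = f, OF _ assms(1) that])
      (use Suc.prems that in \<open>auto simp: frechet_derivative_works\<close>)
  have "Ck_on k S (\<lambda>x. frechet_derivative g (at x) v)" for v
  proof (rule Suc.IH)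
    show "Ck_on k S (\<lambda>x. frechet_derivative f (at x) v)" using Suc.prems by simp
    show "frechet_derivative f (at x) v = frechet_derivative g (at x) v" if "x \<in> S" for x
      using frechet_derivative_at[OF d[OF that]] by simp
  qed
  then show ?case using d by (auto simp: differentiable_def)
qed

lemma Ck_on_linear_combination:
  fixes f :: "'i \<Rightarrow> 'a::real_normed_vector \<Rightarrow> real"
  assumes "open S" "\<And>i. i \<in> I \<Longrightarrow> Ck_on k S (f i)"
  shows "Ck_on k S (\<lambda>x. \<Sum>i\<in>I. a i * f i x)"
  using assms(2)
proof (induction k arbitrary: f)
  case 0
  then show ?case by (auto intro!: continuous_intros)
next
  case (Suc k)
  have d: "((\<lambda>x. \<Sum>i\<in>I. a i * f i x) has_derivative (\<lambda>h. \<Sum>i\<in>I. a i * frechet_derivative (f i) (at x) h)) (at x)"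
    if "x \<in> S" for x
    using Suc.prems that
    by (intro has_derivative_sum has_derivative_mult_right) (auto simp: frechet_derivative_works)
  have "Ck_on k S (\<lambda>x. frechet_derivative (\<lambda>x. \<Sum>i\<in>I. a i * f i x) (at x) v)" for v
  proof (rule Ck_on_cong[OF assms(1)])
    show "Ck_on k S (\<lambda>x. \<Sum>i\<in>I. a i * frechet_derivative (f i) (at x) v)"
      by (rule Suc.IH) (use Suc.prems in auto)
    show "(\<Sum>i\<in>I. a i * frechet_derivative (f i) (at x) v) = frechet_derivative (\<lambda>x. \<Sum>i\<in>I. a i * f i x) (at x) v"
      if "x \<in> S" for x
      by (simp only: frechet_derivative_at[OF d[OF that], symmetric])
  qed
  then show ?case using d by (auto simp: differentiable_def)
qed

text \<open>On constant vectors the exterior derivative is a constant-coefficient combination of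
  first derivatives, so one order of differentiability is spent.\<close>

lemma smooth_on_local_ext_deriv:
  assumes "open S" "\<And>v. smooth_on S (\<lambda>x. \<omega> x v)"
  shows "smooth_on S (\<lambda>x. local_ext_deriv k \<omega> x v)"
  unfolding smooth_on_def local_ext_deriv_omit
proof
  fix n
  have "Ck_on (Suc n) S (\<lambda>x. \<omega> x (omit i v))" for i using assms(2) by (simp only: smooth_on_def)
  then show "Ck_on n S (\<lambda>x. \<Sum>i\<le>k. (-1) ^ i * frechet_derivative (\<lambda>y. \<omega> y (omit i v)) (at x) (v i))"
    by (intro Ck_on_linear_combination[OF assms(1)]) auto
qed


section \<open>Manifolds and forms\<close>

lemma smooth_manifold_chart:
  assumes "smooth_manifold M" "c \<in> atlas M"
  shows "open (cmap c ` cdom c)" "inj_on (cmap c) (cdom c)" "cdom c \<subseteq> points M"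
    and "openin (top_of M) (cdom c)"
    and "openin (top_of M) W \<Longrightarrow> open (cmap c ` (cdom c \<inter> W))"
proof -
  show o: "open (cmap c ` cdom c)" and dom: "openin (top_of M) (cdom c)"
    using assms by (auto simp: smooth_manifold_def)
  show sub: "cdom c \<subseteq> points M" using dom openin_subset by blast
  have hom: "homeomorphic_map (subtopology (top_of M) (cdom c)) (top_of_set (cmap c ` cdom c)) (cmap c)"
    using assms by (auto simp: smooth_manifold_def)
  have ts: "topspace (subtopology (top_of M) (cdom c)) = cdom c" using sub by auto
  show "inj_on (cmap c) (cdom c)"
    using homeomorphic_imp_injective_map[OF hom] by (simp only: ts)
  show "open (cmap c ` (cdom c \<inter> W))" if "openin (top_of M) W"
  proof -
    have "openin (subtopology (top_of M) (cdom c)) (cdom c \<inter> W)"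
      using that by (auto simp: openin_subtopology)
    then have "openin (top_of_set (cmap c ` cdom c)) (cmap c ` (cdom c \<inter> W))"
      using homeomorphic_imp_open_map[OF hom] by (simp add: open_map_def)
    then show ?thesis using o by (rule openin_open_trans)
  qed
qed

lemma cinv_cmap [simp]:
  assumes "smooth_manifold M" "c \<in> atlas M" "p \<in> cdom c"
  shows "cinv c (cmap c p) = p"
  unfolding cinv_def using smooth_manifold_chart(2)[OF assms(1,2)] assms(3) by simp

lemma chart_at:
  assumes "smooth_manifold M" "p \<in> points M"
  shows "chart_at M p \<in> atlas M" "p \<in> cdom (chart_at M p)"
proof -
  have "p \<in> (\<Union>c\<in>atlas M. cdom c)" using assms by (simp add: smooth_manifold_def)
  then have "\<exists>c. c \<in> atlas M \<and> p \<in> cdom c" by blast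
  then have "chart_at M p \<in> atlas M \<and> p \<in> cdom (chart_at M p)"
    unfolding chart_at_def by (rule someI_ex)
  then show "chart_at M p \<in> atlas M" "p \<in> cdom (chart_at M p)" by auto
qed

text \<open>The differential of \<open>f\<close> at \<open>p\<close> relative to arbitrary charts \<open>c\<close> at \<open>p\<close> and \<open>d\<close> at \<open>f p\<close>;
  \<^const>\<open>tangent_map\<close>, \<^const>\<open>to_chart\<close> and \<^const>\<open>from_chart\<close> are instances, so that a single chain
  rule covers them all.\<close>

definition local_diff ::
  "('p, 'e::real_normed_vector) chart \<Rightarrow> ('q, 'f::real_normed_vector) chart \<Rightarrow> ('p \<Rightarrow> 'q) \<Rightarrow> 'p \<Rightarrow> 'e \<Rightarrow> 'f" where
  "local_diff c d f p = frechet_derivative (cmap d \<circ> f \<circ> cinv c) (at (cmap c p))"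

lemma tangent_map_local_diff:
  "tangent_map M N f p = local_diff (chart_at M p) (chart_at N (f p)) f p"
  by (simp add: tangent_map_def local_diff_def)

lemma from_chart_local_diff: "from_chart M c p = local_diff c (chart_at M p) (\<lambda>q. q) p"
  by (simp add: from_chart_def local_diff_def comp_def)

section \<open>Twice differentiable maps and the chain rule\<close>

text \<open>Two derivatives suffice for \<open>d\<close> to commute with pullback, and this class is
  closed under composition by one application of the product rule, with no induction over the order
  of differentiability.\<close>

definition twice_diff_map ::
  "('p, 'e::real_normed_vector) manifold \<Rightarrow> ('q, 'f::real_normed_vector) manifold \<Rightarrow> ('p \<Rightarrow> 'q) \<Rightarrow> bool" where
  "twice_diff_map M N f \<longleftrightarrow> continuous_map (top_of M) (top_of N) f \<and>
     (\<forall>c\<in>atlas M. \<forall>d\<in>atlas N. \<forall>p\<in>cdom c. f p \<in> cdom d \<longrightarrow>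
        (cmap d \<circ> f \<circ> cinv c) differentiable (at (cmap c p)) \<and>
        (\<forall>u. (\<lambda>y. frechet_derivative (cmap d \<circ> f \<circ> cinv c) (at y) u) differentiable (at (cmap c p))))"

lemma smooth_map_imp_twice_diff_map:
  assumes "smooth_map M N f"
  shows "twice_diff_map M N f"
  unfolding twice_diff_map_def
proof (intro conjI ballI impI)
  show "continuous_map (top_of M) (top_of N) f" using assms by (simp add: smooth_map_def)
  fix c d p assume cd: "c \<in> atlas M" "d \<in> atlas N" and p: "p \<in> cdom c" "f p \<in> cdom d"
  have "Ck_on (Suc (Suc 0)) (cmap c ` {p \<in> cdom c. f p \<in> cdom d}) (cmap d \<circ> f \<circ> cinv c)"
    using assms cd unfolding smooth_map_def smooth_on_def by blast
  then show "(cmap d \<circ> f \<circ> cinv c) differentiable (at (cmap c p))"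
    and "\<forall>u. (\<lambda>y. frechet_derivative (cmap d \<circ> f \<circ> cinv c) (at y) u) differentiable (at (cmap c p))"
    using p by auto
qed

text \<open>The chart representations of the identity are the transition maps. Changes of charts
  thereby become instances of the results on maps.\<close>

lemma smooth_map_id:
  assumes "smooth_manifold M"
  shows "smooth_map M M (\<lambda>q. q)"
proof -
  have "cdom c \<inter> cdom d = {p \<in> cdom c. p \<in> cdom d}" for c d :: "('a, 'b) chart" by auto
  then show ?thesis
    using assms by (auto simp: smooth_map_def smooth_manifold_def comp_def)
qed

context
  fixes M :: "('p, 'e::real_normed_vector) manifold" and N :: "('q, 'f::real_normed_vector) manifold" and f
  assumes M: "smooth_manifold M" and N: "smooth_manifold N" and f: "twice_diff_map M N f"
begin

lemma twice_diff_map_open: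
  assumes "c \<in> atlas M" "d \<in> atlas N"
  shows "open (cmap c ` {p \<in> cdom c. f p \<in> cdom d})"
proof -
  have "openin (top_of M) {p \<in> points M. f p \<in> cdom d}"
    using f smooth_manifold_chart(4)[OF N assms(2)]
    by (auto simp: twice_diff_map_def intro: openin_continuous_map_preimage)
  then have "open (cmap c ` (cdom c \<inter> {p \<in> points M. f p \<in> cdom d}))"
    by (rule smooth_manifold_chart(5)[OF M assms(1)])
  also have "cdom c \<inter> {p \<in> points M. f p \<in> cdom d} = {p \<in> cdom c. f p \<in> cdom d}"
    using smooth_manifold_chart(3)[OF M assms(1)] by auto
  finally show ?thesis .
qed

lemma has_derivative_local_diff:
  assumes "c \<in> atlas M" "d \<in> atlas N" "p \<in> cdom c" "f p \<in> cdom d"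
  shows "((cmap d \<circ> f \<circ> cinv c) has_derivative local_diff c d f p) (at (cmap c p))"
  using f assms unfolding twice_diff_map_def local_diff_def by (auto simp: frechet_derivative_works)

lemma linear_local_diff:
  assumes "c \<in> atlas M" "d \<in> atlas N" "p \<in> cdom c" "f p \<in> cdom d"
  shows "linear (local_diff c d f p)"
  using has_derivative_local_diff[OF assms] by (rule has_derivative_linear)

lemma has_second_derivative_local_rep:
  assumes "c \<in> atlas M" "d \<in> atlas N" "p \<in> cdom c" "f p \<in> cdom d"
  obtains D where "\<And>u. ((\<lambda>y. frechet_derivative (cmap d \<circ> f \<circ> cinv c) (at y) u) has_derivative D u) (at (cmap c p))"
proof (rule that)
  show "((\<lambda>y. frechet_derivative (cmap d \<circ> f \<circ> cinv c) (at y) u) has_derivative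
      frechet_derivative (\<lambda>y. frechet_derivative (cmap d \<circ> f \<circ> cinv c) (at y) u) (at (cmap c p))) (at (cmap c p))" for u
    using f assms by (simp add: twice_diff_map_def frechet_derivative_works[symmetric])
qed

text \<open>The composite is factored through the chart \<open>d\<close>; the factored map agrees
  with it on the open set where \<open>f\<close> takes values in the domain of \<open>d\<close>,
  which is enough at \<open>p\<close>.\<close>

lemma has_derivative_local_diff_compose:
  fixes P :: "('r, 'g::real_normed_vector) manifold"
  assumes P: "smooth_manifold P" and g: "twice_diff_map N P g"
    and cd: "c \<in> atlas M" "d \<in> atlas N" "e \<in> atlas P"
    and p: "p \<in> cdom c" "f p \<in> cdom d" "g (f p) \<in> cdom e"
  shows "((cmap e \<circ> (\<lambda>q. g (f q)) \<circ> cinv c) has_derivative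
    (\<lambda>v. local_diff d e g (f p) (local_diff c d f p v))) (at (cmap c p))"
proof -
  have fp: "(cmap d \<circ> f \<circ> cinv c) (cmap c p) = cmap d (f p)" using M cd p by simp
  have "((cmap e \<circ> g \<circ> cinv d) has_derivative local_diff d e g (f p)) (at ((cmap d \<circ> f \<circ> cinv c) (cmap c p)))"
    unfolding fp using g cd p unfolding twice_diff_map_def local_diff_def
    by (auto simp: frechet_derivative_works)
  from diff_chain_at[OF has_derivative_local_diff[OF cd(1,2) p(1,2)] this]
  have D: "((cmap e \<circ> g \<circ> cinv d \<circ> (cmap d \<circ> f \<circ> cinv c)) has_derivative
      (local_diff d e g (f p) \<circ> local_diff c d f p)) (at (cmap c p))" .
  have "((cmap e \<circ> (\<lambda>q. g (f q)) \<circ> cinv c) has_derivative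
      (local_diff d e g (f p) \<circ> local_diff c d f p)) (at (cmap c p))"
  proof (rule has_derivative_transform_within_open[OF D twice_diff_map_open[OF cd(1,2)]])
    show "cmap c p \<in> cmap c ` {p \<in> cdom c. f p \<in> cdom d}" using p by blast
    fix y assume "y \<in> cmap c ` {p \<in> cdom c. f p \<in> cdom d}"
    then obtain q where "y = cmap c q" "q \<in> cdom c" "f q \<in> cdom d" by blast
    then show "(cmap e \<circ> g \<circ> cinv d \<circ> (cmap d \<circ> f \<circ> cinv c)) y = (cmap e \<circ> (\<lambda>q. g (f q)) \<circ> cinv c) y"
      using cd M N by simp
  qed
  then show ?thesis by (simp add: comp_def)
qed

lemma local_diff_compose:
  fixes P :: "('r, 'g::real_normed_vector) manifold"
  assumes "smooth_manifold P" "twice_diff_map N P g"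
    and "c \<in> atlas M" "d \<in> atlas N" "e \<in> atlas P"
    and "p \<in> cdom c" "f p \<in> cdom d" "g (f p) \<in> cdom e"
  shows "local_diff c e (\<lambda>q. g (f q)) p v = local_diff d e g (f p) (local_diff c d f p v)"
  unfolding local_diff_def[of c e] frechet_derivative_at[OF has_derivative_local_diff_compose[OF assms], symmetric] ..

end

text \<open>By the chain rule the first derivative of the composite is
  \<open>G' (F y) (F' y u)\<close> near the point: a linear map and an argument that both vary with
  \<open>y\<close>.\<close>

lemma twice_diff_map_compose:
  fixes M :: "('p, 'e::real_normed_vector) manifold" and N :: "('q, 'f::real_normed_vector) manifold"
    and P :: "('r, 'g::real_normed_vector) manifold"
  assumes M: "smooth_manifold M" and N: "smooth_manifold N" and P: "smooth_manifold P"
    and f: "twice_diff_map M N f" and g: "twice_diff_map N P g"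
  shows "twice_diff_map M P (\<lambda>q. g (f q))"
  unfolding twice_diff_map_def
proof (intro conjI ballI impI allI)
  have cont: "continuous_map (top_of M) (top_of N) f" "continuous_map (top_of N) (top_of P) g"
    using f g by (auto simp: twice_diff_map_def)
  show cgf: "continuous_map (top_of M) (top_of P) (\<lambda>q. g (f q))"
    using continuous_map_compose[OF cont] by (simp add: comp_def)
  fix c e p assume ce: "c \<in> atlas M" "e \<in> atlas P" and p: "p \<in> cdom c" "g (f p) \<in> cdom e"
  have fp: "f p \<in> points N"
    using cont(1) p(1) smooth_manifold_chart(3)[OF M ce(1)] by (auto simp: continuous_map_def)
  define d where "d = chart_at N (f p)"
  have d: "d \<in> atlas N" "f p \<in> cdom d" using chart_at[OF N fp] by (auto simp: d_def)
  note D = has_derivative_local_diff_compose[OF M N f P g ce(1) d(1) ce(2)]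
  show "(cmap e \<circ> (\<lambda>q. g (f q)) \<circ> cinv c) differentiable (at (cmap c p))"
    using D[OF p(1) d(2) p(2)] by (auto simp: differentiable_def)
  define F where "F = cmap d \<circ> f \<circ> cinv c"
  define G where "G = cmap e \<circ> g \<circ> cinv d"
  define F' where "F' y = frechet_derivative F (at y)" for y
  define G' where "G' y = frechet_derivative G (at y)" for y
  define T where "T = {q \<in> points M. f q \<in> cdom d} \<inter> {q \<in> points M. g (f q) \<in> cdom e}"
  have "openin (top_of M) T"
    unfolding T_def
    using smooth_manifold_chart(4)[OF N d(1)] smooth_manifold_chart(4)[OF P ce(2)] cont(1) cgf
    by (intro openin_Int openin_continuous_map_preimage) auto
  then have S: "open (cmap c ` (cdom c \<inter> T))" by (rule smooth_manifold_chart(5)[OF M ce(1)])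
  have x: "cmap c p \<in> cmap c ` (cdom c \<inter> T)"
    using p d smooth_manifold_chart(3)[OF M ce(1)] by (auto simp: T_def)
  have F: "F (cmap c q) = cmap d (f q)" if "q \<in> cdom c" for q
    using that M ce by (simp add: F_def)
  fix u
  obtain A where A: "((\<lambda>y. F' y u) has_derivative A) (at (cmap c p))"
    using has_second_derivative_local_rep[OF M N f ce(1) d(1) p(1) d(2)] unfolding F'_def F_def by blast
  obtain B where B: "\<And>u. ((\<lambda>y. G' y u) has_derivative B u) (at (F (cmap c p)))"
    unfolding F[OF p(1)] using has_second_derivative_local_rep[OF N P g d(1) ce(2) d(2) p(2)]
    unfolding G'_def G_def by blast
  have F': "(F has_derivative F' (cmap c q)) (at (cmap c q))" if "q \<in> cdom c \<inter> T" for q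
    using has_derivative_local_diff[OF M N f ce(1) d(1), of q] that
    by (auto simp: F_def F'_def local_diff_def T_def)
  have G': "(G has_derivative G' (F (cmap c q))) (at (F (cmap c q)))" if "q \<in> cdom c \<inter> T" for q
    using has_derivative_local_diff[OF N P g d(1) ce(2), of "f q"] that
    by (auto simp: F G_def G'_def local_diff_def T_def)
  have GF: "((\<lambda>y. G' (F y) z) has_derivative (\<lambda>h. B z (F' (cmap c p) h))) (at (cmap c p))" for z
    by (rule has_derivative_compose[OF F' B]) (use p d smooth_manifold_chart(3)[OF M ce(1)] in \<open>auto simp: T_def\<close>)
  have lin: "linear (G' (F y))" if "y \<in> cmap c ` (cdom c \<inter> T)" for y
    using that G' has_derivative_linear by blast
  have fd: "\<exists>B :: 'f set. finite B \<and> span B = UNIV" using N by (simp add: smooth_manifold_def)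
  \<comment> \<open>The Leibniz rule with a single slot: a linear map is treated as a form that
    reads only entry 0 of a sequence.\<close>
  have "((\<lambda>y. G' (F y) (F' y u)) has_derivative
      (\<lambda>h. B (F' (cmap c p) u) (F' (cmap c p) h) + (\<Sum>m<Suc 0. G' (F (cmap c p)) (((\<lambda>_. F' (cmap c p) u)(m := A h)) 0))))
      (at (cmap c p))"
    by (rule multilinear_has_derivative[OF fd S x, where \<Omega> = "\<lambda>y v. G' (F y) (v 0)"
          and V = "\<lambda>y _. F' y u" and k = "Suc 0" and V' = "\<lambda>_. A" and \<Omega>' = "\<lambda>v h. B (v 0) (F' (cmap c p) h)"])
      (use lin A GF in auto)
  then have "((\<lambda>y. frechet_derivative (cmap e \<circ> (\<lambda>q. g (f q)) \<circ> cinv c) (at y) u) has_derivative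
      (\<lambda>h. B (F' (cmap c p) u) (F' (cmap c p) h) + (\<Sum>m<Suc 0. G' (F (cmap c p)) (((\<lambda>_. F' (cmap c p) u)(m := A h)) 0))))
      (at (cmap c p))"
  proof (rule has_derivative_transform_within_open[OF _ S x])
    fix y assume "y \<in> cmap c ` (cdom c \<inter> T)"
    then obtain q where q: "y = cmap c q" "q \<in> cdom c" "f q \<in> cdom d" "g (f q) \<in> cdom e"
      by (auto simp: T_def)
    show "G' (F y) (F' y u) = frechet_derivative (cmap e \<circ> (\<lambda>q. g (f q)) \<circ> cinv c) (at y) u"
      using local_diff_compose[OF M N f P g ce(1) d(1) ce(2) q(2-), of u]
      unfolding q(1) F[OF q(2)] unfolding G'_def F'_def G_def F_def local_diff_def by simp
  qed
  then show "(\<lambda>y. frechet_derivative (cmap e \<circ> (\<lambda>q. g (f q)) \<circ> cinv c) (at y) u) differentiable (at (cmap c p))"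
    unfolding differentiable_def by blast
qed

section \<open>Forms in charts and naturality of the exterior derivative\<close>

lemma alternating_form_compose_linear:
  assumes "alternating_form k \<omega>" "linear L"
  shows "alternating_form k (\<lambda>v. \<omega> (\<lambda>i. L (v i)))"
proof -
  have upd: "(\<lambda>j. L ((v(i := x)) j)) = (\<lambda>j. L (v j))(i := L x)" for v i x by auto
  show ?thesis
    unfolding alternating_form_def
  proof (intro conjI allI impI)
    show "linear (\<lambda>x. \<omega> (\<lambda>j. L ((v(i := x)) j)))" if "i < k" for v i
      unfolding upd
      using linear_compose[OF assms(2) alternating_formD(2)[OF assms(1) that]] by (simp add: comp_def)
    show "\<omega> (\<lambda>i. L (v i)) = \<omega> (\<lambda>i. L (w i))" if "\<forall>i<k. v i = w i" for v w
      by (rule alternating_formD(1)[OF assms(1)]) (use that in simp)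
    show "\<omega> (\<lambda>i. L (v i)) = 0" if "i < k" "j < k" "i \<noteq> j \<and> v i = v j" for v i j
      by (rule alternating_formD(3)[OF assms(1) that(1,2)]) (use that in auto)
  qed
qed

lemma linear_from_chart:
  assumes M: "smooth_manifold M" and c: "c \<in> atlas M" "p \<in> cdom c"
  shows "linear (from_chart M c p)"
proof -
  have p: "p \<in> points M" using smooth_manifold_chart(3)[OF M c(1)] c(2) by blast
  show ?thesis
    unfolding from_chart_local_diff
    by (rule linear_local_diff[OF M M smooth_map_imp_twice_diff_map[OF smooth_map_id[OF M]] c(1) chart_at(1)[OF M p] c(2)])
      (rule chart_at(2)[OF M p])
qed

lemma form_in_chart:
  assumes M: "smooth_manifold M" and \<phi>: "differential_form M k \<phi>" and c: "c \<in> atlas M" and x: "x \<in> cmap c ` cdom c"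
  shows "alternating_form k (form_in_chart M c \<phi> x)"
    and "(\<lambda>y. form_in_chart M c \<phi> y v) differentiable (at x)"
proof -
  obtain p where p: "x = cmap c p" "p \<in> cdom c" "p \<in> points M"
    using x smooth_manifold_chart(3)[OF M c] by blast
  have "form_in_chart M c \<phi> x = (\<lambda>v. \<phi> p (\<lambda>i. from_chart M c p (v i)))"
    using M c p by (simp add: form_in_chart_def fun_eq_iff)
  then show "alternating_form k (form_in_chart M c \<phi> x)"
    using \<phi> p linear_from_chart[OF M c p(2)]
    by (auto simp: differential_form_def intro: alternating_form_compose_linear)
  have "Ck_on (Suc 0) (cmap c ` cdom c) (\<lambda>y. form_in_chart M c \<phi> y v)"
    using \<phi> c by (simp only: differential_form_def smooth_on_def)
  then show "(\<lambda>y. form_in_chart M c \<phi> y v) differentiable (at x)"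
    unfolding p(1) using p(2) by simp
qed

text \<open>The pullback \<open>f\<^sup>*\<phi>\<close> written in the chart \<open>c\<close> of the source of \<open>f\<close>.\<close>

definition chart_pullback ::
  "('p, 'e::real_normed_vector) chart \<Rightarrow> ('q, 'f::real_normed_vector) manifold \<Rightarrow> ('p \<Rightarrow> 'q) \<Rightarrow> ('q, 'f) form \<Rightarrow> ('e, 'e) form" where
  "chart_pullback c N f \<phi> y v =
     \<phi> (f (cinv c y)) (\<lambda>i. local_diff c (chart_at N (f (cinv c y))) f (cinv c y) (v i))"

lemma form_in_chart_pullback: "form_in_chart M c \<phi> = chart_pullback c M (\<lambda>q. q) \<phi>"
  by (simp add: form_in_chart_def chart_pullback_def from_chart_local_diff fun_eq_iff)

text \<open>Naturality of \<open>d\<close>, read in the chart \<open>c\<close>. The preferred chart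
  at \<open>f q\<close> may jump as \<open>q\<close> moves, so near \<open>p\<close> everything is
  rewritten in the one chart \<open>d\<close> preferred at \<open>f p\<close>, in which
  \<open>ext_deriv\<close> is computed there. Then naturality in coordinates applies.\<close>

lemma local_ext_deriv_chart_pullback:
  fixes M :: "('p, 'e::real_normed_vector) manifold" and N :: "('q, 'f::real_normed_vector) manifold"
  assumes M: "smooth_manifold M" and N: "smooth_manifold N" and f: "twice_diff_map M N f"
    and \<phi>: "differential_form N k \<phi>" and c: "c \<in> atlas M" and p: "p \<in> cdom c"
  shows "local_ext_deriv k (chart_pullback c N f \<phi>) (cmap c p) v
    = chart_pullback c N f (ext_deriv N k \<phi>) (cmap c p) v"
proof -
  have pts: "q \<in> points M" "f q \<in> points N" if "q \<in> cdom c" for q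
    using that smooth_manifold_chart(3)[OF M c] f by (auto simp: twice_diff_map_def continuous_map_def)
  define d where "d = chart_at N (f p)"
  have d: "d \<in> atlas N" "f p \<in> cdom d" using chart_at[OF N pts(2)[OF p]] by (auto simp: d_def)
  define S where "S = cmap c ` {q \<in> cdom c. f q \<in> cdom d}"
  define F where "F = cmap d \<circ> f \<circ> cinv c"
  define F' where "F' y = frechet_derivative F (at y)" for y
  have S: "open S" unfolding S_def by (rule twice_diff_map_open[OF M N f c d(1)])
  have x: "cmap c p \<in> S" using p d by (auto simp: S_def)
  have F: "F (cmap c q) = cmap d (f q)" if "q \<in> cdom c" for q
    using that M c by (simp add: F_def)
  have F'_ld: "F' (cmap c q) = local_diff c d f q" for q by (simp add: F'_def F_def local_diff_def)
  have F': "(F has_derivative F' y) (at y)" if "y \<in> S" for y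
    using that has_derivative_local_diff[OF M N f c d(1)]
    by (auto simp: S_def F_def F'_ld)
  obtain F'' where F'': "\<And>u. ((\<lambda>y. F' y u) has_derivative F'' u) (at (cmap c p))"
    using has_second_derivative_local_rep[OF M N f c d(1) p d(2)] unfolding F'_def F_def by blast
  have FS: "F y \<in> cmap d ` cdom d" if "y \<in> S" for y
    using that F by (auto simp: S_def)
  have fd: "\<exists>B :: 'f set. finite B \<and> span B = UNIV" using N by (simp add: smooth_manifold_def)
  \<comment> \<open>The chain rule splits off the change from \<open>d\<close> to the preferred
    chart at \<open>f q\<close>; this factor is the \<open>from_chart\<close> contained in
    \<open>form_in_chart\<close>.\<close>
  have eq: "chart_pullback c N f \<phi> y w = form_in_chart N d \<phi> (F y) (\<lambda>i. F' y (w i))" if y: "y \<in> S" for y w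
  proof -
    obtain q where q: "y = cmap c q" "q \<in> cdom c" "f q \<in> cdom d" using y by (auto simp: S_def)
    note fq = chart_at[OF N pts(2)[OF q(2)]]
    have "local_diff c (chart_at N (f q)) f q z = from_chart N d (f q) (local_diff c d f q z)" for z
      unfolding from_chart_local_diff
      using local_diff_compose[OF M N f N smooth_map_imp_twice_diff_map[OF smooth_map_id[OF N]]
          c d(1) fq(1) q(2,3) fq(2)] by simp
    then show ?thesis
      using M N c d q by (simp add: chart_pullback_def form_in_chart_def F F'_ld)
  qed
  have "local_ext_deriv k (chart_pullback c N f \<phi>) (cmap c p) v
      = local_ext_deriv k (\<lambda>y w. form_in_chart N d \<phi> (F y) (\<lambda>i. F' y (w i))) (cmap c p) v"
    by (rule local_ext_deriv_cong[OF S x eq])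
  also have "\<dots> = local_ext_deriv k (form_in_chart N d \<phi>) (F (cmap c p)) (\<lambda>i. F' (cmap c p) (v i))"
    by (rule local_ext_deriv_pullback[OF fd S x F' F'' form_in_chart(1)[OF N \<phi> d(1) FS] form_in_chart(2)[OF N \<phi> d(1) FS[OF x]]])
  also have "\<dots> = chart_pullback c N f (ext_deriv N k \<phi>) (cmap c p) v"
    using M c p by (simp add: chart_pullback_def ext_deriv_def F F'_ld d_def)
  finally show ?thesis .
qed

text \<open>Naturality for the identity map says that in every chart the exterior derivative is
  given by the coordinate formula, from which smoothness is read off.\<close>

lemma differential_form_ext_deriv:
  assumes M: "smooth_manifold M" and \<phi>: "differential_form M k \<phi>"
  shows "differential_form M (Suc k) (ext_deriv M k \<phi>)"
  unfolding differential_form_def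
proof (intro conjI ballI allI)
  fix p assume p: "p \<in> points M"
  note c = chart_at[OF M p]
  show "alternating_form (Suc k) (ext_deriv M k \<phi> p)"
    unfolding ext_deriv_def
    by (rule alternating_form_local_ext_deriv[OF smooth_manifold_chart(1)[OF M c(1)] _
          form_in_chart(1)[OF M \<phi> c(1)] form_in_chart(2)[OF M \<phi> c(1)]])
      (use c(2) in auto)
next
  fix c v assume c: "c \<in> atlas M"
  note o = smooth_manifold_chart(1)[OF M c]
  have sm: "smooth_on (cmap c ` cdom c) (\<lambda>x. local_ext_deriv k (form_in_chart M c \<phi>) x v)"
    by (rule smooth_on_local_ext_deriv[OF o]) (use \<phi> c in \<open>simp add: differential_form_def\<close>)
  have eq: "local_ext_deriv k (form_in_chart M c \<phi>) x v = form_in_chart M c (ext_deriv M k \<phi>) x v"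
    if "x \<in> cmap c ` cdom c" for x
    using that local_ext_deriv_chart_pullback[OF M M smooth_map_imp_twice_diff_map[OF smooth_map_id[OF M]] \<phi> c]
    unfolding form_in_chart_pullback by blast
  show "smooth_on (cmap c ` cdom c) (\<lambda>x. form_in_chart M c (ext_deriv M k \<phi>) x v)"
    unfolding smooth_on_def
  proof
    show "Ck_on n (cmap c ` cdom c) (\<lambda>x. form_in_chart M c (ext_deriv M k \<phi>) x v)" for n
      by (rule Ck_on_cong[OF o, where f = "\<lambda>x. local_ext_deriv k (form_in_chart M c \<phi>) x v"])
        (use sm eq in \<open>simp_all add: smooth_on_def\<close>)
  qed
qed

section \<open>Connections\<close>

text \<open>The sum decomposition gives existence, the trivial intersection with the kernel of the
  linear map \<open>dsrc X g\<close> gives uniqueness; together they justify the \<open>THE\<close>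
  in the definition.\<close>

lemma horizontal_proj:
  assumes X: "lie_groupoid X" and H: "connection X H" and g: "g \<in> points (Arr X)"
  shows "horizontal_proj X H g v \<in> H g" and "v \<in> H g \<Longrightarrow> horizontal_proj X H g v = v"
proof -
  have sub: "subspace (H g)"
    using H g by (auto simp: connection_def smooth_distribution_def)
  have int: "H g \<inter> ker_dsrc X g = {0}" using H g by (auto simp: connection_def)
  have man: "smooth_manifold (Arr X)" "smooth_manifold (Obj X)"
    and src: "twice_diff_map (Arr X) (Obj X) (src X)" and "src X g \<in> points (Obj X)"
    using X g smooth_map_imp_twice_diff_map
    by (auto simp: lie_groupoid_def submersion_def groupoid_laws_def)
  then have lin: "linear (dsrc X g)"
    unfolding tangent_map_local_diff
    by (intro linear_local_diff[OF man src] chart_at g) auto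
  have ex1: "\<exists>!h. h \<in> H g \<and> v - h \<in> ker_dsrc X g" for v
  proof -
    have "\<exists>h\<in>H g. \<exists>w\<in>ker_dsrc X g. v = h + w" using H g by (simp add: connection_def)
    then obtain h w where hw: "h \<in> H g" "w \<in> ker_dsrc X g" "v = h + w" by blast
    have uniq: "h = h'" if "h \<in> H g" "v - h \<in> ker_dsrc X g" "h' \<in> H g" "v - h' \<in> ker_dsrc X g" for h h'
    proof -
      have "h - h' \<in> H g" by (rule subspace_diff[OF sub that(1,3)])
      moreover have "h - h' \<in> ker_dsrc X g"
        using that by (simp add: ker_dsrc_def linear_diff[OF lin])
      ultimately have "h - h' \<in> H g \<inter> ker_dsrc X g" by (rule IntI)
      then show ?thesis by (simp add: int)
    qed
    show ?thesis
    proof (rule ex1I[of _ h])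
      show h: "h \<in> H g \<and> v - h \<in> ker_dsrc X g" using hw by simp
      show "h' = h" if "h' \<in> H g \<and> v - h' \<in> ker_dsrc X g" for h'
        by (rule uniq) (use that h in simp_all)
    qed
  qed
  show "horizontal_proj X H g v \<in> H g"
    unfolding horizontal_proj_def using theI'[OF ex1[of v]] by blast
  show "horizontal_proj X H g v = v" if "v \<in> H g"
    unfolding horizontal_proj_def
    by (rule the1_equality[OF ex1]) (use that in \<open>simp add: ker_dsrc_def linear_0[OF lin]\<close>)
qed

theorem lemma3p11:
  fixes X :: "('a, 'e::real_normed_vector, 'b, 'f::real_normed_vector) groupoid"
    and H :: "'b \<Rightarrow> 'f set"
    and \<phi> :: "('a, 'e) form"
    and k :: nat
  assumes "lie_groupoid X"
    and "integrable_connection X H"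
    and "groupoid_form X H k \<phi>"
  shows "groupoid_form X H (k + 1) (ext_deriv (Obj X) k \<phi>)"
proof -
  let ?A = "Arr X" and ?O = "Obj X"
  have man: "smooth_manifold ?A" "smooth_manifold ?O"
    and src: "twice_diff_map ?A ?O (src X)" and tgt: "twice_diff_map ?A ?O (tgt X)"
    and st: "\<And>g. g \<in> points ?A \<Longrightarrow> src X g \<in> points ?O" "\<And>g. g \<in> points ?A \<Longrightarrow> tgt X g \<in> points ?O"
    using assms(1) smooth_map_imp_twice_diff_map
    by (auto simp: lie_groupoid_def submersion_def groupoid_laws_def)
  have con: "connection X H" and integ: "integrable_distribution TYPE('e) ?A H"
    using assms(2) by (auto simp: integrable_connection_def)
  note proj = horizontal_proj[OF assms(1) con]
  have \<phi>: "differential_form ?O k \<phi>" using assms(3) by (simp add: groupoid_form_def)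
  have horiz: "\<phi> (src X q) (\<lambda>i. dsrc X q (w i)) = \<phi> (tgt X q) (\<lambda>i. dtgt X q (w i))"
    if "q \<in> points ?A" "\<And>i. w i \<in> H q" for q w
  proof -
    have "horizontal_part X H (pullback ?A ?O (src X) \<phi>) q w = horizontal_part X H (pullback ?A ?O (tgt X) \<phi>) q w"
      using assms(3) that(1) unfolding groupoid_form_def by simp
    then show ?thesis using proj(2)[OF that(1)] that(2) by (simp add: horizontal_part_def pullback_def)
  qed
  have "horizontal_part X H (pullback ?A ?O (src X) (ext_deriv ?O k \<phi>)) g v
      = horizontal_part X H (pullback ?A ?O (tgt X) (ext_deriv ?O k \<phi>)) g v" if g: "g \<in> points ?A" for g v
  proof -
    obtain N :: "('b, 'e) manifold" where N: "integral_manifold ?A H N" "g \<in> points N"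
      using integ g unfolding integrable_distribution_def by blast
    let ?\<iota> = "\<lambda>q::'b. q"
    have smN: "smooth_manifold N" and \<iota>: "twice_diff_map N ?A ?\<iota>"
      and range: "\<And>q. q \<in> points N \<Longrightarrow> range (tangent_map N ?A ?\<iota> q) = H q"
      using N(1) smooth_map_imp_twice_diff_map by (auto simp: integral_manifold_def immersion_def)
    have NA: "q \<in> points ?A" if "q \<in> points N" for q
      using \<iota> that by (auto simp: twice_diff_map_def continuous_map_def)
    have idN: "twice_diff_map N N ?\<iota>" by (rule smooth_map_imp_twice_diff_map[OF smooth_map_id[OF smN]])
    define c where "c = chart_at N g"
    have c: "c \<in> atlas N" "g \<in> cdom c" using chart_at[OF smN N(2)] by (auto simp: c_def)
    have cN: "q \<in> points N" if "q \<in> cdom c" for q using that smooth_manifold_chart(3)[OF smN c(1)] by blast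
    \<comment> \<open>The differential of the inclusion of \<open>N\<close>, taken in the fixed
      chart \<open>c\<close> on \<open>N\<close> but in the preferred chart at each point of the
      arrow manifold, since \<open>H q\<close> is expressed in the latter.\<close>
    define L where "L q = local_diff c (chart_at ?A q) ?\<iota> q" for q
    have LH: "L q z \<in> H q" if q: "q \<in> cdom c" for q z
    proof -
      note cq = chart_at[OF smN cN[OF q]] and aq = chart_at[OF man(1) NA[OF cN[OF q]]]
      \<comment> \<open>Passing from \<open>c\<close> to the preferred chart at \<open>q\<close>
        only reparametrizes the tangent space of \<open>N\<close>, so the image stays in
        \<open>H q\<close>.\<close>
      have "L q z = tangent_map N ?A ?\<iota> q (local_diff c (chart_at N q) ?\<iota> q z)"
        unfolding L_def tangent_map_local_diff
        using local_diff_compose[OF smN smN idN man(1) \<iota> c(1) cq(1) aq(1) q cq(2) aq(2)] by simp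
      then show ?thesis using range[OF cN[OF q]] by blast
    qed
    have chain: "local_diff c (chart_at ?O (f q)) f q z = tangent_map ?A ?O f q (L q z)"
      if q: "q \<in> cdom c" and f: "twice_diff_map ?A ?O f" "f q \<in> points ?O" for q z f
      unfolding L_def tangent_map_local_diff
      by (rule local_diff_compose[OF smN man(1) \<iota> man(2) f(1) c(1)])
        (use q chart_at[OF man(1) NA[OF cN[OF q]]] chart_at[OF man(2) f(2)] in auto)
    have pb: "chart_pullback c ?O (src X) \<psi> (cmap c q) w = \<psi> (src X q) (\<lambda>i. dsrc X q (L q (w i)))"
      "chart_pullback c ?O (tgt X) \<psi> (cmap c q) w = \<psi> (tgt X q) (\<lambda>i. dtgt X q (L q (w i)))"
      if q: "q \<in> cdom c" for \<psi> :: "('a, 'e) form" and q w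
      using chain[OF q src st(1)] chain[OF q tgt st(2)] NA[OF cN[OF q]] cinv_cmap[OF smN c(1) q]
      by (simp_all add: chart_pullback_def)
    \<comment> \<open>Equality holds on the whole open chart image and not just at the image of
      \<open>g\<close>, so both sides have the same exterior derivative.\<close>
    have agree: "chart_pullback c ?O (src X) \<phi> y w = chart_pullback c ?O (tgt X) \<phi> y w"
      if "y \<in> cmap c ` cdom c" for y w
      using that horiz NA cN LH by (auto simp: pb)
    have sN: "twice_diff_map N ?O (src X)" and tN: "twice_diff_map N ?O (tgt X)"
      using twice_diff_map_compose[OF smN man(1,2) \<iota>] src tgt by auto
    \<comment> \<open>As \<open>c\<close> is the preferred chart at \<open>g\<close>, the map
      \<open>L g\<close> is the tangent map of the inclusion, whose range is \<open>H g\<close>.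
      Hence the projected vectors lift to coordinate vectors \<open>w\<close> on
      \<open>N\<close>.\<close>
    define P where "P i = horizontal_proj X H g (v i)" for i
    have "\<exists>z. P i = L g z" for i
    proof -
      have "P i \<in> range (tangent_map N ?A ?\<iota> g)"
        unfolding range[OF N(2)] P_def by (rule proj(1)[OF g])
      then show ?thesis by (auto simp: L_def c_def tangent_map_local_diff)
    qed
    then obtain w where w: "\<And>i. P i = L g (w i)" by metis
    have "chart_pullback c ?O (src X) (ext_deriv ?O k \<phi>) (cmap c g) w
        = local_ext_deriv k (chart_pullback c ?O (src X) \<phi>) (cmap c g) w"
      by (rule local_ext_deriv_chart_pullback[OF smN man(2) sN \<phi> c, symmetric])
    also have "\<dots> = local_ext_deriv k (chart_pullback c ?O (tgt X) \<phi>) (cmap c g) w"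
      by (rule local_ext_deriv_cong[OF smooth_manifold_chart(1)[OF smN c(1)] _ agree]) (use c in auto)
    also have "\<dots> = chart_pullback c ?O (tgt X) (ext_deriv ?O k \<phi>) (cmap c g) w"
      by (rule local_ext_deriv_chart_pullback[OF smN man(2) tN \<phi> c])
    finally show ?thesis
      by (simp add: pb[OF c(2)] w[symmetric] horizontal_part_def pullback_def P_def)
  qed
  then show ?thesis
    using differential_form_ext_deriv[OF man(2) \<phi>] by (simp add: groupoid_form_def fun_eq_iff)
qed

end
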